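(* Let $n \geqslant 2.16\times 10^{17}$ and let $G$ be a planar graph on $n$ vertices that does not contain $C_{3,3}$ as a subgraph. Then $\rho(G)\leqslant \rho(K_2+H(1,1))$, with equality if and only if $G\cong K_2+H(1,1)$. Here $H(1,1)$ is the graph consisting of $n-2$ isolated vertices, so $K_2+H(1,1)$ is the graph on $n$ vertices obtained from an edge $u'u''$ and $n-2$ further vertices, each adjacent to both $u'$ and $u''$ (and to nothing else).
   Context: All graphs are finite and simple. $\rho(G)$ denotes the spectral radius (largest eigenvalue modulus) of the adjacency matrix of $G$. For $l\geqslant 3$, $C_{l,l}$ denotes the graph consisting of two cycles of length $l$ sharing exactly one common vertex (so it has $2l-1$ vertices); $C_{3,3}$ is two triangles sharing a vertex. For graphs $G_1,G_2$, $G_1+G_2$ denotes their join: the disjoint union of $G_1$ and $G_2$ together with all edges joining every vertex of $G_1$ to every vertex of $G_2$. $K_2$ is the complete graph on two vertices. *)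

theory Defs
  imports "HOL-Analysis.Analysis"
begin

definition simple_graph :: "'a set \<Rightarrow> 'a set set \<Rightarrow> bool" where
  "simple_graph V E \<longleftrightarrow> finite V \<and> (\<forall>e\<in>E. e \<subseteq> V \<and> card e = 2)"

definition adj_eigenvalue :: "'a set \<Rightarrow> 'a set set \<Rightarrow> complex \<Rightarrow> bool" where
  "adj_eigenvalue V E \<mu> \<longleftrightarrow>
     (\<exists>x :: 'a \<Rightarrow> complex. (\<exists>v\<in>V. x v \<noteq> 0) \<and>
        (\<forall>v\<in>V. (\<Sum>w\<in>{w\<in>V. {v, w} \<in> E}. x w) = \<mu> * x v))"

definition spectral_radius :: "'a set \<Rightarrow> 'a set set \<Rightarrow> real" where
  "spectral_radius V E = Max {cmod \<mu> | \<mu>. adj_eigenvalue V E \<mu>}"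

definition contains_subgraph :: "'a set \<Rightarrow> 'a set set \<Rightarrow> 'b set \<Rightarrow> 'b set set \<Rightarrow> bool" where
  "contains_subgraph V E V' E' \<longleftrightarrow>
     (\<exists>f. inj_on f V' \<and> f ` V' \<subseteq> V \<and> (\<forall>e\<in>E'. f ` e \<in> E))"

definition graph_iso :: "'a set \<Rightarrow> 'a set set \<Rightarrow> 'b set \<Rightarrow> 'b set set \<Rightarrow> bool" where
  "graph_iso V E V' E' \<longleftrightarrow>
     (\<exists>f. bij_betw f V V' \<and> (\<forall>u\<in>V. \<forall>v\<in>V. {u, v} \<in> E \<longleftrightarrow> {f u, f v} \<in> E'))"

definition planar :: "'a set \<Rightarrow> 'a set set \<Rightarrow> bool" where
  "planar V E \<longleftrightarrow>
     (\<exists>(p :: 'a \<Rightarrow> complex) (\<gamma> :: 'a set \<Rightarrow> real \<Rightarrow> complex).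
        inj_on p V \<and>
        (\<forall>e\<in>E. arc (\<gamma> e) \<and> {pathstart (\<gamma> e), pathfinish (\<gamma> e)} = p ` e) \<and>
        (\<forall>e\<in>E. \<forall>v\<in>V. p v \<in> path_image (\<gamma> e) \<longrightarrow> v \<in> e) \<and>
        (\<forall>e\<in>E. \<forall>e'\<in>E. e \<noteq> e' \<longrightarrow> path_image (\<gamma> e) \<inter> path_image (\<gamma> e') \<subseteq> p ` (e \<inter> e')))"

text \<open>C_{3,3}: two triangles {0,1,2} and {0,3,4} sharing the vertex 0.\<close>
definition C33_verts :: "nat set" where
  "C33_verts = {0, 1, 2, 3, 4}"

definition C33_edges :: "nat set set" where
  "C33_edges = {{0, 1}, {1, 2}, {0, 2}, {0, 3}, {3, 4}, {0, 4}}"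

definition K2_join_verts :: "nat \<Rightarrow> nat set" where
  "K2_join_verts n = {0..<n}"

definition K2_join_edges :: "nat \<Rightarrow> nat set set" where
  "K2_join_edges n = {{0, 1}} \<union> {{0, i} | i. 2 \<le> i \<and> i < n} \<union> {{1, i} | i. 2 \<le> i \<and> i < n}"

end

theory Submission
  imports Defs
begin

text \<open>
  Planarity enters only through the absence of a \<open>K\<^sub>3\<^sub>,\<^sub>3\<close> minor. If the plane contained a drawing of
  one, two of its branch sets would be the poles of a theta curve with a third branch set reaching all
  three arcs; Janiszewski's theorem, applied to two of the three cycles of the theta, would then join
  the two sides of the third cycle, against the Jordan curve theorem.

  A graph without such a minor has fewer than \<open>6|U|\<close> edges on every vertex set \<open>U\<close>, and any three
  vertices have at most two common neighbours. Let \<open>G\<close> have spectral radius \<open>\<rho>\<close> at least that of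
  \<open>K\<^sub>2 + H(1,1)\<close>, so \<open>\<rho>\<^sup>2 \<ge> 2n\<close>, and let \<open>x\<close> be a nonnegative eigenvector with maximum 1. Expanding
  \<open>\<rho>\<^sup>2 x\<^sub>u\<close> over walks of length two shows first that vertices with \<open>x\<^sub>u \<ge> 1/300\<close> have degree linear in
  \<open>n\<close>, hence are few, and that all but few vertices see at most two of them; then that there are two
  vertices \<open>a\<close>, \<open>b\<close> with entries close to 1 which share more than 93 percent of all vertices as
  neighbours; and finally that all other entries are at most \<open>0.058\<close>. Replacing the edges of \<open>G\<close>
  by those of the hub graph on \<open>a\<close>, \<open>b\<close> therefore does not decrease the quadratic form of \<open>x\<close>, and equality forces
  \<open>G\<close> to be that hub graph.
\<close>

section \<open>Theta curves and topological \<open>K\<^sub>3\<^sub>,\<^sub>3\<close>\<close>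

text \<open>Excluded minors take the place of Euler's formula here. The price is the density 6|U|
  instead of 3|U|, which larger constants absorb.

  The size of n is needed to absorb exceptional vertices: there are at most 42858 heavy vertices,
  any three of them have at most two common neighbours, so at most 2.63 * 10^13 vertices see three
  heavy ones. They contribute about 12 each to a sum over walks of length two, and this must stay
  below 0.0015 n.

  The absence of C_{3,3} acts between the common neighbours of the hubs. If the hubs are adjacent,
  one edge there, with a third common neighbour, closes two triangles at a hub. If they are not, all
  edges there meet one fixed edge, and their total weight is smaller than what the missing hub edge
  would bring. Because of this trade the common neighbours are kept apart from the remaining
  vertices in the final comparison.\<close>

lemma theta_third_side:
  fixes O' :: "complex set"
  assumes c: "connected O'" "frontier O' = C" and P: "P \<subseteq> C" "p \<in> P" "p \<in> L" "connected L"
    and y: "y \<in> O'" "x \<in> L" and d: "O' \<inter> S = {}" "P \<inter> S = {}" "L \<inter> S = {}"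
  shows "connected_component (- S) y x"
proof -
  \<comment> \<open>\<open>O' \<union> P\<close> lies between \<open>O'\<close> and its closure, so
    boundary points may be added at will; \<open>p\<close> is the gate through which
    \<open>L\<close> is entered.\<close>
  have "connected (O' \<union> P)"
    using connected_intermediate_closure[OF c(1), of "O' \<union> P"] c(2) P(1)
    by (auto simp: frontier_def closure_subset)
  then have "connected ((O' \<union> P) \<union> L)"
    by (rule connected_Un) (use P in auto)
  moreover have "(O' \<union> P) \<union> L \<subseteq> - S" using d by auto
  ultimately show ?thesis
    unfolding connected_component_def using y by blast
qed

text \<open>The cycle split by the Jordan curve theorem is the one made of \<open>g1\<close> and
  \<open>g3\<close>. The arc \<open>g2\<close> then does double duty: with \<open>L2\<close> it
  marks the side containing \<open>x\<close>, and it is the connected intersection of the other two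
  cycles that Janiszewski's theorem asks for.\<close>

lemma theta_separates:
  fixes g1 g2 g3 :: "real \<Rightarrow> complex"
  assumes arcs: "arc g1" "arc g2" "arc g3"
    and ends: "pathstart g1 = a" "pathfinish g1 = b" "pathstart g2 = a" "pathfinish g2 = b"
      "pathstart g3 = a" "pathfinish g3 = b"
    and int: "path_image g1 \<inter> path_image g2 \<subseteq> {a,b}" "path_image g1 \<inter> path_image g3 \<subseteq> {a,b}"
      "path_image g2 \<inter> path_image g3 \<subseteq> {a,b}"
    and conn: "connected L1" "connected L2" "connected L3" and x: "x \<in> L1" "x \<in> L2" "x \<in> L3"
    and meet: "L1 \<inter> path_image g1 \<noteq> {}" "L2 \<inter> path_image g2 \<noteq> {}" "L3 \<inter> path_image g3 \<noteq> {}"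
    and avoid: "L1 \<inter> path_image g2 = {}" "L1 \<inter> path_image g3 = {}"
      "L2 \<inter> path_image g1 = {}" "L2 \<inter> path_image g3 = {}"
      "L3 \<inter> path_image g1 = {}" "L3 \<inter> path_image g2 = {}"
  shows False
proof -
  let ?P1 = "path_image g1" and ?P2 = "path_image g2" and ?P3 = "path_image g3"
  have ab: "{a,b} \<subseteq> ?P1" "{a,b} \<subseteq> ?P2" "{a,b} \<subseteq> ?P3"
    using ends pathstart_in_path_image[of g1] pathstart_in_path_image[of g2] pathstart_in_path_image[of g3]
      pathfinish_in_path_image[of g1] pathfinish_in_path_image[of g2] pathfinish_in_path_image[of g3]
    by auto
  \<comment> \<open>The poles lie on every arc, so a set that avoids another arc can meet this one
    only away from \<open>a\<close> and \<open>b\<close>.\<close>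
  have obt: "\<exists>z\<in>L. z \<in> P - {a,b}" if "L \<inter> P \<noteq> {}" "L \<inter> Q = {}" "{a,b} \<subseteq> Q" for L P Q
    using that by fastforce
  have sp: "simple_path (g1 +++ reversepath g3)"
    by (rule simple_path_join_loop) (use arcs ends int in \<open>auto simp: arc_reversepath\<close>)
  have lp: "pathfinish (g1 +++ reversepath g3) = pathstart (g1 +++ reversepath g3)"
    using ends by simp
  have im: "path_image (g1 +++ reversepath g3) = ?P1 \<union> ?P3"
    using ends by (simp add: path_image_join)
  obtain U W where UW: "U \<noteq> {}" "connected U" "W \<noteq> {}" "connected W" "open U" "open W"
    "U \<inter> W = {}" "U \<union> W = - (?P1 \<union> ?P3)" "frontier U = ?P1 \<union> ?P3" "frontier W = ?P1 \<union> ?P3"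
    by (rule Jordan_curve[OF sp lp]) (simp add: im)
  let ?Q = "(?P2 - {a,b}) \<union> L2"
  have "connected (?P2 - {a,b})"
    using connected_simple_path_endless[OF arc_imp_simple_path[OF arcs(2)]] ends by simp
  moreover have "(?P2 - {a,b}) \<inter> L2 \<noteq> {}" using obt[OF meet(2) avoid(3) ab(1)] by auto
  ultimately have Q: "connected ?Q" using conn by (intro connected_Un)
  have "?Q \<subseteq> U \<union> W" using int avoid UW(8) by auto
  moreover have "?Q \<inter> U = {} \<or> ?Q \<inter> W = {}"
    using connectedD[OF Q UW(5,6)] UW(7) calculation by blast
  ultimately have "?Q \<subseteq> U \<or> ?Q \<subseteq> W" by blast
  \<comment> \<open>\<open>I\<close> is the side that holds the open middle arc and
    \<open>L2\<close>, hence \<open>x\<close>; \<open>O'\<close> is the opposite side, with the same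
    frontier.\<close>
  then obtain O' I where O: "O' \<noteq> {}" "connected O'" "frontier O' = ?P1 \<union> ?P3" "O' \<inter> I = {}"
    "?Q \<subseteq> I" "O' \<union> I = - (?P1 \<union> ?P3)" "open O'" "open I"
    using UW by (metis Int_commute Un_commute)
  obtain y where y: "y \<in> O'" using O by auto
  have O2: "O' \<inter> ?P1 = {}" "O' \<inter> ?P3 = {}" "O' \<inter> ?P2 = {}"
    using O(4-6) ab by auto
  \<comment> \<open>Leave \<open>O'\<close> through a point of \<open>g3\<close> and follow
    \<open>L3\<close> to \<open>x\<close>: this avoids \<open>g1\<close> and \<open>g2\<close>. The
    next claim leaves through \<open>g1\<close> and follows \<open>L1\<close>.\<close>
  have c12: "connected_component (- (?P1 \<union> ?P2)) y x"
  proof -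
    obtain p where p: "p \<in> L3" "p \<in> ?P3 - {a,b}" using obt[OF meet(3) avoid(5) ab(1)] by auto
    show ?thesis
      by (rule theta_third_side[OF O(2,3), of "?P3 - {a,b}" p L3])
        (use p conn x y avoid int O2 in auto)
  qed
  have c23: "connected_component (- (?P2 \<union> ?P3)) y x"
  proof -
    obtain p where p: "p \<in> L1" "p \<in> ?P1 - {a,b}" using obt[OF meet(1) avoid(1) ab(2)] by auto
    show ?thesis
      by (rule theta_third_side[OF O(2,3), of "?P1 - {a,b}" p L1])
        (use p conn x y avoid int O2 in auto)
  qed
  have "(?P1 \<union> ?P2) \<inter> (?P2 \<union> ?P3) = ?P2" using int(2) ab(2) by auto
  then have "connected_component (- ((?P1 \<union> ?P2) \<union> (?P2 \<union> ?P3))) y x"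
    using arcs by (intro Janiszewski[OF _ _ _ c12 c23])
      (simp_all add: compact_Un compact_arc_image connected_arc_image compact_imp_closed)
  then obtain T where T: "connected T" "T \<subseteq> - ((?P1 \<union> ?P2) \<union> (?P2 \<union> ?P3))" "y \<in> T" "x \<in> T"
    unfolding connected_component_def by blast
  have "T \<subseteq> O' \<union> I" using T O(6) by blast
  moreover have "x \<in> I" using O(5) x by blast
  ultimately show False
    using connectedD[OF T(1) O(7,8)] T(3,4) y O(4) by blast
qed

text \<open>The centre is the first point where a path from \<open>p3\<close> hits an arc from
  \<open>p1\<close> to \<open>p2\<close>. Legs may shrink to points, since the three points may
  coincide; hence they are compact path-connected sets and not arcs.\<close>

lemma path_connected_tripod:
  fixes S :: "complex set"
  assumes S: "path_connected S" "p1 \<in> S" "p2 \<in> S" "p3 \<in> S"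
  obtains c T1 T2 T3 where "c \<in> T1" "c \<in> T2" "c \<in> T3" "p1 \<in> T1" "p2 \<in> T2" "p3 \<in> T3"
    "T1 \<subseteq> S" "T2 \<subseteq> S" "T3 \<subseteq> S" "path_connected T1" "path_connected T2" "path_connected T3"
    "compact T1" "compact T2" "compact T3"
    "T1 \<inter> T2 \<subseteq> {c}" "T1 \<inter> T3 \<subseteq> {c}" "T2 \<inter> T3 \<subseteq> {c}"
proof (cases "p1 = p2")
  case True
  obtain g where "path g" "path_image g \<subseteq> S" "pathstart g = p1" "pathfinish g = p3"
    using S unfolding path_connected_def by blast
  then show ?thesis using True S
    by (intro that[of p1 "{p1}" "{p1}" "path_image g"])
      (auto simp: path_connected_path_image)
next
  case False
  obtain h where h: "path h" "path_image h \<subseteq> S" "pathstart h = p1" "pathfinish h = p2"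
    using S unfolding path_connected_def by blast
  obtain r where r: "arc r" "path_image r \<subseteq> S" "pathstart r = p1" "pathfinish r = p2"
    by (rule path_contains_arc[OF h(1,3,4) False]) (use h(2) in auto)
  obtain g where g: "path g" "path_image g \<subseteq> S" "pathstart g = p3" "pathfinish g = p1"
    using S unfolding path_connected_def by blast
  let ?K = "{0..1} \<inter> g -` path_image r"
  have "closed ?K"
    by (rule continuous_closed_preimage)
      (use g r in \<open>auto simp: path_def intro!: compact_imp_closed compact_arc_image\<close>)
  then have "compact ?K" by (simp add: bounded_Int compact_eq_bounded_closed)
  moreover have "1 \<in> ?K"
    using g(4) r(3) pathstart_in_path_image[of r] by (auto simp: pathfinish_def)
  ultimately obtain t where t: "t \<in> ?K" "\<And>s. s \<in> ?K \<Longrightarrow> t \<le> s"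
    using compact_attains_inf[of ?K] by blast
  obtain s where s: "s \<in> {0..1}" "g t = r s" using t by (auto simp: path_image_def)
  have inj: "inj_on r {0..1}" and pr: "path r" using r by (auto simp: arc_def)
  show ?thesis
  proof (rule that[of "g t" "path_image (subpath 0 s r)" "path_image (subpath s 1 r)" "path_image (subpath 0 t g)"])
    have e: "path_image (subpath 0 s r) = r ` {0..s}" "path_image (subpath s 1 r) = r ` {s..1}"
      "path_image (subpath 0 t g) = g ` {0..t}"
      using s t by (auto simp: path_image_subpath)
    have t01: "0 \<le> t" "t \<le> 1" using t by auto
    show "g t \<in> path_image (subpath 0 s r)" "g t \<in> path_image (subpath s 1 r)"
      unfolding e using s by auto
    show "g t \<in> path_image (subpath 0 t g)"
      unfolding e using t01 by auto
    show "p1 \<in> path_image (subpath 0 s r)" "p2 \<in> path_image (subpath s 1 r)"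
       "p3 \<in> path_image (subpath 0 t g)"
      unfolding e using s t01 r g by (auto simp: pathstart_def pathfinish_def)
    show "path_image (subpath 0 s r) \<subseteq> S" "path_image (subpath s 1 r) \<subseteq> S"
      "path_image (subpath 0 t g) \<subseteq> S"
      unfolding e using s t01 r g by (auto simp: path_image_def)
    show "path_connected (path_image (subpath 0 s r))" "path_connected (path_image (subpath s 1 r))"
       "path_connected (path_image (subpath 0 t g))"
      using s t01 pr g by (auto intro!: path_connected_path_image)
    show "compact (path_image (subpath 0 s r))" "compact (path_image (subpath s 1 r))"
       "compact (path_image (subpath 0 t g))"
      using s t01 pr g by (auto intro!: compact_path_image)
    show "path_image (subpath 0 s r) \<inter> path_image (subpath s 1 r) \<subseteq> {g t}"
      unfolding e s(2)
    proof (clarsimp)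
      fix u v assume "0 \<le> u" "u \<le> s" "s \<le> v" "v \<le> 1" "r u = r v"
      then have "u = v" using s inj by (auto simp: inj_on_def)
      then have "u = s" using \<open>u \<le> s\<close> \<open>s \<le> v\<close> by simp
      then show "r v = r s" using \<open>u = v\<close> by simp
    qed
    have z: "g ` {0..t} \<inter> path_image r \<subseteq> {g t}"
      using t t01 by force
    have "r ` {0..s} \<subseteq> path_image r" "r ` {s..1} \<subseteq> path_image r"
      using s by (auto simp: path_image_def)
    then    show "path_image (subpath 0 s r) \<inter> path_image (subpath 0 t g) \<subseteq> {g t}"
      "path_image (subpath s 1 r) \<inter> path_image (subpath 0 t g) \<subseteq> {g t}"
      using z unfolding e by blast+
  qed
qed

text \<open>An arc missing \<open>B\<close> would meet both closed sets \<open>F\<close> and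
  \<open>H\<close> and be covered by them, although they have no common point off \<open>B\<close>;
  connectedness forbids this. The forced visit to \<open>B\<close> is what lets a third branch set
  touch the arc.\<close>

lemma arc_through_middle:
  fixes F B H :: "complex set"
  assumes "path_connected F" "path_connected B" "path_connected H" "F \<inter> B \<noteq> {}" "B \<inter> H \<noteq> {}"
    and "closed F" "closed H" "F \<inter> H \<subseteq> B" "c \<in> F" "d \<in> H" "c \<noteq> d"
  obtains g where "arc g" "path_image g \<subseteq> F \<union> B \<union> H" "pathstart g = c" "pathfinish g = d"
    "path_image g \<inter> B \<noteq> {}"
proof -
  have "path_connected (F \<union> B)" using assms by (intro path_connected_Un)
  then have "path_connected (F \<union> B \<union> H)"
    by (rule path_connected_Un) (use assms in auto)
  then obtain h where h: "path h" "path_image h \<subseteq> F \<union> B \<union> H" "pathstart h = c" "pathfinish h = d"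
    using assms unfolding path_connected_def by blast
  obtain g where g: "arc g" "path_image g \<subseteq> F \<union> B \<union> H" "pathstart g = c" "pathfinish g = d"
    by (rule path_contains_arc[OF h(1,3,4) \<open>c \<noteq> d\<close>]) (use h(2) in auto)
  have "path_image g \<inter> B \<noteq> {}"
  proof
    assume "path_image g \<inter> B = {}"
    moreover have "c \<in> path_image g" "d \<in> path_image g"
      using g pathstart_in_path_image[of g] pathfinish_in_path_image[of g] by auto
    ultimately show False
      using connected_closedD[OF connected_arc_image[OF g(1)], of F H] assms(6-10) g(2) by auto
  qed
  then show ?thesis using that g by blast
qed

text \<open>\<open>A 0\<close> and \<open>A 1\<close> become the two poles of a theta whose arcs run through the \<open>B j\<close>; then
  \<open>A 2\<close> reaches all three arcs without crossing the theta.\<close>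

lemma no_topological_K33:
  fixes A B :: "nat \<Rightarrow> complex set" and e :: "nat \<Rightarrow> nat \<Rightarrow> complex set" and p :: "nat \<Rightarrow> nat \<Rightarrow> complex"
  assumes A: "\<And>i. i < 3 \<Longrightarrow> path_connected (A i)"
    and B: "\<And>i. i < 3 \<Longrightarrow> path_connected (B i)"
    and e: "\<And>i j. i < 3 \<Longrightarrow> j < 3 \<Longrightarrow> path_connected (e i j) \<and> compact (e i j)"
    and AA: "\<And>i j. i < 3 \<Longrightarrow> j < 3 \<Longrightarrow> i \<noteq> j \<Longrightarrow> A i \<inter> A j = {}"
    and BB: "\<And>i j. i < 3 \<Longrightarrow> j < 3 \<Longrightarrow> i \<noteq> j \<Longrightarrow> B i \<inter> B j = {}"
    and AB: "\<And>i j. i < 3 \<Longrightarrow> j < 3 \<Longrightarrow> A i \<inter> B j = {}"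
    and eA: "\<And>i j. i < 3 \<Longrightarrow> j < 3 \<Longrightarrow> e i j \<inter> A i = {p i j}"
    and eB: "\<And>i j. i < 3 \<Longrightarrow> j < 3 \<Longrightarrow> e i j \<inter> B j \<noteq> {}"
    and eA': "\<And>i j k. i < 3 \<Longrightarrow> j < 3 \<Longrightarrow> k < 3 \<Longrightarrow> k \<noteq> i \<Longrightarrow> e i j \<inter> A k = {}"
    and eB': "\<And>i j k. i < 3 \<Longrightarrow> j < 3 \<Longrightarrow> k < 3 \<Longrightarrow> k \<noteq> j \<Longrightarrow> e i j \<inter> B k = {}"
    and ee: "\<And>i j k l. i < 3 \<Longrightarrow> j < 3 \<Longrightarrow> k < 3 \<Longrightarrow> l < 3 \<Longrightarrow> i \<noteq> k \<or> j \<noteq> l \<Longrightarrow>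
        e i j \<inter> e k l \<subseteq> (A i \<inter> A k) \<union> (B j \<inter> B l)"
  shows False
proof -
  have lt3: "(0::nat) < 3" "(1::nat) < 3" by simp_all
  have leg_edge: "T \<inter> e \<subseteq> {c}" if "T \<subseteq> A" "q \<in> U" "T \<inter> U \<subseteq> {c}" "e \<inter> A = {q}"
    for T A U e :: "complex set" and q c
  proof
    fix x assume x: "x \<in> T \<inter> e"
    then have "x \<in> e \<inter> A" using that(1) by auto
    then have "x = q" using that(4) by simp
    then show "x \<in> {c}" using that x by auto
  qed
  have sub_disj: "X \<inter> Z = {}" if "X \<subseteq> A" "Z \<subseteq> B" "A \<inter> B = {}" for X Z A B :: "complex set"
    using that by blast
  have ee0: "e i j \<inter> e k l = {}" if "i < 3" "j < 3" "k < 3" "l < 3" "i \<noteq> k" "j \<noteq> l" for i j k l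
  proof -
    have "A i \<inter> A k = {}" "B j \<inter> B l = {}" using AA BB that by auto
    then show ?thesis using ee[of i j k l] that by blast
  qed
  \<comment> \<open>Inside a branch set the three attachment points are joined to one centre by legs
    that otherwise do not overlap; the centres of \<open>A 0\<close> and \<open>A 1\<close> are the
    poles.\<close>
  have tripod: "\<exists>c T. (\<forall>j<3. c \<in> T j \<and> p i j \<in> T j \<and> T j \<subseteq> A i \<and> path_connected (T j) \<and> compact (T j)) \<and>
     (\<forall>j<3. \<forall>k<3. j \<noteq> k \<longrightarrow> T j \<inter> T k \<subseteq> {c})" if i: "i < 3" for i
  proof -
    have "p i j \<in> A i" if "j < 3" for j using eA[OF i that] by blast
    then have "p i 0 \<in> A i" "p i 1 \<in> A i" "p i 2 \<in> A i" by simp_all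
    then obtain c T0 T1 T2 where "c \<in> T0" "c \<in> T1" "c \<in> T2" "p i 0 \<in> T0" "p i 1 \<in> T1" "p i 2 \<in> T2"
    "T0 \<subseteq> A i" "T1 \<subseteq> A i" "T2 \<subseteq> A i" "path_connected T0" "path_connected T1" "path_connected T2"
    "compact T0" "compact T1" "compact T2"
    "T0 \<inter> T1 \<subseteq> {c}" "T0 \<inter> T2 \<subseteq> {c}" "T1 \<inter> T2 \<subseteq> {c}"
      by (rule path_connected_tripod[OF A[OF i]])
    then show ?thesis
      by (intro exI[of _ c] exI[of _ "\<lambda>j. if j = 0 then T0 else if j = 1 then T1 else T2"])
        (auto simp: less_Suc_eq numeral_3_eq_3 numeral_2_eq_2)
  qed
  obtain c T where T0: "\<forall>j<3. c \<in> T j \<and> p 0 j \<in> T j \<and> T j \<subseteq> A 0 \<and> path_connected (T j) \<and> compact (T j)"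
    "\<forall>j<3. \<forall>k<3. j \<noteq> k \<longrightarrow> T j \<inter> T k \<subseteq> {c}"
    using tripod[OF lt3(1)] by blast
  then have T: "\<And>j. j < 3 \<Longrightarrow> c \<in> T j" "\<And>j. j < 3 \<Longrightarrow> p 0 j \<in> T j" "\<And>j. j < 3 \<Longrightarrow> T j \<subseteq> A 0"
    "\<And>j. j < 3 \<Longrightarrow> path_connected (T j)" "\<And>j. j < 3 \<Longrightarrow> compact (T j)"
    "\<And>j k. j < 3 \<Longrightarrow> k < 3 \<Longrightarrow> j \<noteq> k \<Longrightarrow> T j \<inter> T k \<subseteq> {c}"
    by simp_all
  obtain d Y where Y0: "\<forall>j<3. d \<in> Y j \<and> p 1 j \<in> Y j \<and> Y j \<subseteq> A 1 \<and> path_connected (Y j) \<and> compact (Y j)"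
    "\<forall>j<3. \<forall>k<3. j \<noteq> k \<longrightarrow> Y j \<inter> Y k \<subseteq> {d}"
    using tripod[OF lt3(2)] by blast
  then have Y: "\<And>j. j < 3 \<Longrightarrow> d \<in> Y j" "\<And>j. j < 3 \<Longrightarrow> p 1 j \<in> Y j" "\<And>j. j < 3 \<Longrightarrow> Y j \<subseteq> A 1"
    "\<And>j. j < 3 \<Longrightarrow> path_connected (Y j)" "\<And>j. j < 3 \<Longrightarrow> compact (Y j)"
    "\<And>j k. j < 3 \<Longrightarrow> k < 3 \<Longrightarrow> j \<noteq> k \<Longrightarrow> Y j \<inter> Y k \<subseteq> {d}"
    by simp_all
  \<comment> \<open>The corridor of the \<open>j\<close>-th arc: leg and edge out of
    \<open>A 0\<close>, then \<open>B j\<close>, then edge and leg into \<open>A 1\<close>.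
    Different corridors meet at the poles only, so any choice of arcs inside them forms a
    theta.\<close>
  define M where "M j = (T j \<union> e 0 j) \<union> B j \<union> (e 1 j \<union> Y j)" for j
  have "c \<in> A 0" "d \<in> A 1" using T(1,3)[of 0] Y(1,3)[of 0] by auto
  then have cd: "c \<noteq> d" using AA[of 0 1] by auto
  have "\<exists>g. arc g \<and> path_image g \<subseteq> M j \<and> pathstart g = c \<and> pathfinish g = d \<and> path_image g \<inter> B j \<noteq> {}"
    if j: "j < 3" for j
  proof -
    have 1: "path_connected (T j \<union> e 0 j)"
      by (rule path_connected_Un) (use T[OF j] e[of 0 j] eA[of 0 j] j in auto)
    have 2: "path_connected (e 1 j \<union> Y j)"
      by (rule path_connected_Un) (use Y[OF j] e[of 1 j] eA[of 1 j] j in auto)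
    have 3: "(T j \<union> e 0 j) \<inter> B j \<noteq> {}" "B j \<inter> (e 1 j \<union> Y j) \<noteq> {}"
      using eB[of 0 j] eB[of 1 j] j by auto
    have 4: "closed (T j \<union> e 0 j)" "closed (e 1 j \<union> Y j)"
      using T(5)[OF j] Y(5)[OF j] e[of 0 j] e[of 1 j] j by (auto intro!: closed_Un compact_imp_closed)
    have 5: "(T j \<union> e 0 j) \<inter> (e 1 j \<union> Y j) \<subseteq> B j"
      using T(3)[OF j] Y(3)[OF j] AA[of 0 1] eA'[of 1 j 0] eA'[of 0 j 1] ee[of 0 j 1 j] j by auto
    show ?thesis unfolding M_def
      by (rule arc_through_middle[OF 1 B[OF j] 2 3 4 5, of c d]) (use T(1)[OF j] Y(1)[OF j] cd in auto)
  qed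
  then obtain g where g: "\<And>j. j < 3 \<Longrightarrow> arc (g j)" "\<And>j. j < 3 \<Longrightarrow> path_image (g j) \<subseteq> M j"
    "\<And>j. j < 3 \<Longrightarrow> pathstart (g j) = c" "\<And>j. j < 3 \<Longrightarrow> pathfinish (g j) = d"
    "\<And>j. j < 3 \<Longrightarrow> path_image (g j) \<inter> B j \<noteq> {}"
    by metis
  have MM: "M i \<inter> M j \<subseteq> {c,d}" if ij: "i < 3" "j < 3" "i \<noteq> j" for i j
  proof -
    have TT: "(T i \<union> e 0 i) \<inter> (T j \<union> e 0 j) \<subseteq> {c}"
    proof -
      have *: "e 0 i \<inter> A 0 = {p 0 i}" "e 0 j \<inter> A 0 = {p 0 j}" "e 0 i \<inter> e 0 j \<subseteq> A 0"
        using eA[of 0 i] eA[of 0 j] ee[of 0 i 0 j] BB[OF ij] ij by simp_all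
      have "T i \<inter> e 0 j \<subseteq> {c}"
        by (rule leg_edge[OF T(3)[OF ij(1)] T(2)[OF ij(2)] T(6)[OF ij] *(2)])
      moreover have "e 0 i \<inter> T j \<subseteq> {c}"
        using leg_edge[OF T(3)[OF ij(2)] T(2)[OF ij(1)] _ *(1)] T(6)[OF ij] by (simp add: Int_commute)
      moreover have "e 0 i \<inter> e 0 j \<subseteq> T i \<inter> e 0 j"
      proof -
        have "e 0 i \<inter> e 0 j \<subseteq> e 0 i \<inter> A 0" using *(3) by auto
        then show ?thesis using T(2)[OF ij(1)] *(1) by auto
      qed
      ultimately show ?thesis using T(6)[OF ij] by blast
    qed
    have YY: "(e 1 i \<union> Y i) \<inter> (e 1 j \<union> Y j) \<subseteq> {d}"
    proof -
      have *: "e 1 i \<inter> A 1 = {p 1 i}" "e 1 j \<inter> A 1 = {p 1 j}" "e 1 i \<inter> e 1 j \<subseteq> A 1"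
        using eA[of 1 i] eA[of 1 j] ee[of 1 i 1 j] BB[OF ij] ij by simp_all
      have "Y i \<inter> e 1 j \<subseteq> {d}"
        by (rule leg_edge[OF Y(3)[OF ij(1)] Y(2)[OF ij(2)] Y(6)[OF ij] *(2)])
      moreover have "e 1 i \<inter> Y j \<subseteq> {d}"
        using leg_edge[OF Y(3)[OF ij(2)] Y(2)[OF ij(1)] _ *(1)] Y(6)[OF ij] by (simp add: Int_commute)
      moreover have "e 1 i \<inter> e 1 j \<subseteq> Y i \<inter> e 1 j"
      proof -
        have "e 1 i \<inter> e 1 j \<subseteq> e 1 i \<inter> A 1" using *(3) by auto
        then show ?thesis using Y(2)[OF ij(1)] *(1) by auto
      qed
      ultimately show ?thesis using Y(6)[OF ij] by blast
    qed
    have TY: "(T k \<union> e 0 k) \<inter> (e 1 l \<union> Y l) = {}" if kl: "k < 3" "l < 3" "k \<noteq> l" for k l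
    proof -
      have "T k \<inter> Y l = {}" using sub_disj[OF T(3) Y(3)] AA[of 0 1] kl by simp
      moreover have "e 0 k \<inter> e 1 l = {}" using ee0[of 0 k 1 l] kl by simp
      moreover have "T k \<inter> e 1 l = {}" using sub_disj[OF T(3)[OF kl(1)] subset_refl, of "e 1 l"] eA'[of 1 l 0] kl by (simp add: Int_commute)
      moreover have "e 0 k \<inter> Y l = {}" using sub_disj[OF subset_refl Y(3)] eA'[of 0 k 1] kl by simp
      ultimately show ?thesis by blast
    qed
    have TB: "(T k \<union> e 0 k) \<inter> B l = {}" "(e 1 k \<union> Y k) \<inter> B l = {}" if kl: "k < 3" "l < 3" "k \<noteq> l" for k l
    proof -
      have "T k \<inter> B l = {}" "Y k \<inter> B l = {}" "e 0 k \<inter> B l = {}" "e 1 k \<inter> B l = {}"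
        using sub_disj[OF T(3)[of k] subset_refl] sub_disj[OF Y(3)[of k] subset_refl] AB[of 0 l] AB[of 1 l]
          eB'[of 0 k l] eB'[of 1 k l] kl by simp_all
      then show "(T k \<union> e 0 k) \<inter> B l = {}" "(e 1 k \<union> Y k) \<inter> B l = {}" by blast+
    qed
    have gen: "(F \<union> B \<union> H) \<inter> (F' \<union> B' \<union> H') \<subseteq> {c,d}"
      if "F \<inter> F' \<subseteq> {c}" "F \<inter> B' = {}" "F \<inter> H' = {}" "F' \<inter> B = {}" "B \<inter> B' = {}" "H' \<inter> B = {}"
        "F' \<inter> H = {}" "H \<inter> B' = {}" "H \<inter> H' \<subseteq> {d}" for F B H F' B' H'
      using that by auto
    show ?thesis
      unfolding M_def
      by (rule gen[OF TT TB(1)[OF ij] TY[OF ij] TB(1) BB[OF ij] TB(2) TY TB(2)[OF ij] YY]) (use ij in simp_all)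
  qed
  \<comment> \<open>\<open>A 2\<close> extended through its edge into \<open>B j\<close>. It avoids
    the corridors of the other indices, and all three extensions share the point
    \<open>p 2 0\<close> of \<open>A 2\<close>.\<close>
  define L where "L j = A 2 \<union> e 2 j \<union> B j" for j
  have LM: "L i \<inter> M j = {}" if ij: "i < 3" "j < 3" "i \<noteq> j" for i j
  proof -
    have "X \<inter> M j = {}" if "X \<inter> A 0 = {}" "X \<inter> A 1 = {}" "X \<inter> e 0 j = {}" "X \<inter> e 1 j = {}" "X \<inter> B j = {}" for X
    proof -
      have "X \<inter> T j = {}" "X \<inter> Y j = {}"
        using sub_disj[OF subset_refl T(3)[OF ij(2)] that(1)] sub_disj[OF subset_refl Y(3)[OF ij(2)] that(2)] by simp_all
      then show ?thesis unfolding M_def using that by blast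
    qed
    note * = this
    have "A 2 \<inter> M j = {}"
      by (rule *) (use AA[of 2 0] AA[of 2 1] AB[of 2 j] eA'[of 0 j 2] eA'[of 1 j 2] ij in \<open>simp_all add: Int_commute\<close>)
    moreover have "e 2 i \<inter> M j = {}"
      by (rule *) (use eA'[of 2 i 0] eA'[of 2 i 1] ee0[of 2 i 0 j] ee0[of 2 i 1 j] eB'[of 2 i j] ij in simp_all)
    moreover have "B i \<inter> M j = {}"
      by (rule *) (use AB[of 0 i] AB[of 1 i] BB[OF ij] eB'[of 0 j i] eB'[of 1 j i] ij in \<open>simp_all add: Int_commute\<close>)
    ultimately show ?thesis unfolding L_def by blast
  qed
  have Lc: "connected (L j)" if j: "j < 3" for j
  proof -
    have "path_connected (A 2 \<union> e 2 j)"
      by (rule path_connected_Un) (use A[of 2] e[of 2 j] eA[of 2 j] j in auto)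
    then have "path_connected (L j)" unfolding L_def
      by (rule path_connected_Un) (use B[OF j] eB[of 2 j] j in auto)
    then show ?thesis by (rule path_connected_imp_connected)
  qed
  have x: "p 2 0 \<in> L j" for j using eA[of 2 0] by (auto simp: L_def)
  have Lg: "L i \<inter> path_image (g j) = {}" if "i < 3" "j < 3" "i \<noteq> j" for i j
    using LM[OF that] g(2)[of j] that by blast
  have gg: "path_image (g i) \<inter> path_image (g j) \<subseteq> {c,d}" if "i < 3" "j < 3" "i \<noteq> j" for i j
    using MM[OF that] g(2)[of i] g(2)[of j] that by blast
  have Lm: "L j \<inter> path_image (g j) \<noteq> {}" if "j < 3" for j
    using g(5)[OF that] by (auto simp: L_def)
  show False
    by (rule theta_separates[of "g 0" "g 1" "g 2" c d "L 0" "L 1" "L 2" "p 2 0"])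
      (use g Lc x Lg gg Lm in simp_all)
qed

section \<open>Minors\<close>

text \<open>Connectivity by cuts rather than by walks: for a union it suffices to find a part split
  by the cut or a joining edge that crosses it. Being stated for any relation, it applies again when
  branch sets become vertices.\<close>

definition conn_set :: "('a \<Rightarrow> 'a \<Rightarrow> bool) \<Rightarrow> 'a set \<Rightarrow> bool" where
  "conn_set r A \<longleftrightarrow> A \<noteq> {} \<and> (\<forall>X. X \<subseteq> A \<and> X \<noteq> {} \<and> X \<noteq> A \<longrightarrow> (\<exists>x\<in>X. \<exists>y\<in>A - X. r x y))"

definition K33_minor :: "('a \<Rightarrow> 'a \<Rightarrow> bool) \<Rightarrow> 'a set \<Rightarrow> bool" where
  "K33_minor r V \<longleftrightarrow> (\<exists>A B :: nat \<Rightarrow> 'a set.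
     (\<forall>i<3. conn_set r (A i) \<and> A i \<subseteq> V \<and> conn_set r (B i) \<and> B i \<subseteq> V) \<and>
     (\<forall>i<3. \<forall>j<3. i \<noteq> j \<longrightarrow> A i \<inter> A j = {} \<and> B i \<inter> B j = {}) \<and>
     (\<forall>i<3. \<forall>j<3. A i \<inter> B j = {} \<and> (\<exists>x\<in>A i. \<exists>y\<in>B j. r x y)))"

abbreviation adj :: "'a set set \<Rightarrow> 'a \<Rightarrow> 'a \<Rightarrow> bool" where
  "adj E u v \<equiv> {u, v} \<in> E"

text \<open>Each branch set is turned into its part of the drawing, which is path-connected.
  Disjoint vertex sets have disjoint parts, and one chosen edge per pair supplies the nine
  connections.\<close>

lemma planar_no_K33_minor:
  assumes G: "simple_graph V E" and pl: "planar V E"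
  shows "\<not> K33_minor (adj E) V"
proof
  assume "K33_minor (adj E) V"
  then obtain A B :: "nat \<Rightarrow> 'a set" where
    1: "\<forall>i<3. conn_set (adj E) (A i) \<and> A i \<subseteq> V \<and> conn_set (adj E) (B i) \<and> B i \<subseteq> V"
    and 2: "\<forall>i<3. \<forall>j<3. i \<noteq> j \<longrightarrow> A i \<inter> A j = {} \<and> B i \<inter> B j = {}"
    and 3: "\<forall>i<3. \<forall>j<3. A i \<inter> B j = {} \<and> (\<exists>x\<in>A i. \<exists>y\<in>B j. {x, y} \<in> E)"
    unfolding K33_minor_def by (elim exE conjE)
  have cA: "\<And>i. i < 3 \<Longrightarrow> conn_set (adj E) (A i)" and AV: "\<And>i. i < 3 \<Longrightarrow> A i \<subseteq> V"
    and cB: "\<And>i. i < 3 \<Longrightarrow> conn_set (adj E) (B i)" and BV: "\<And>i. i < 3 \<Longrightarrow> B i \<subseteq> V"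
    and AA: "\<And>i j. i < 3 \<Longrightarrow> j < 3 \<Longrightarrow> i \<noteq> j \<Longrightarrow> A i \<inter> A j = {}"
    and BB: "\<And>i j. i < 3 \<Longrightarrow> j < 3 \<Longrightarrow> i \<noteq> j \<Longrightarrow> B i \<inter> B j = {}"
    and AB: "\<And>i j. i < 3 \<Longrightarrow> j < 3 \<Longrightarrow> A i \<inter> B j = {}"
    and ex: "\<And>i j. i < 3 \<Longrightarrow> j < 3 \<Longrightarrow> \<exists>x\<in>A i. \<exists>y\<in>B j. {x, y} \<in> E"
    using 1 2 3 by simp_all
  obtain p :: "'a \<Rightarrow> complex" and \<gamma> where inj: "inj_on p V"
    and 4: "\<forall>e\<in>E. arc (\<gamma> e) \<and> {pathstart (\<gamma> e), pathfinish (\<gamma> e)} = p ` e"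
    and 5: "\<forall>e\<in>E. \<forall>v\<in>V. p v \<in> path_image (\<gamma> e) \<longrightarrow> v \<in> e"
    and 6: "\<forall>e\<in>E. \<forall>e'\<in>E. e \<noteq> e' \<longrightarrow> path_image (\<gamma> e) \<inter> path_image (\<gamma> e') \<subseteq> p ` (e \<inter> e')"
    using pl unfolding planar_def by (elim exE conjE)
  have arc: "\<And>e. e \<in> E \<Longrightarrow> arc (\<gamma> e)" and ends: "\<And>e. e \<in> E \<Longrightarrow> {pathstart (\<gamma> e), pathfinish (\<gamma> e)} = p ` e"
    and pv: "\<And>e v. e \<in> E \<Longrightarrow> v \<in> V \<Longrightarrow> p v \<in> path_image (\<gamma> e) \<Longrightarrow> v \<in> e"
    and dis: "\<And>e e'. e \<in> E \<Longrightarrow> e' \<in> E \<Longrightarrow> e \<noteq> e' \<Longrightarrow> path_image (\<gamma> e) \<inter> path_image (\<gamma> e') \<subseteq> p ` (e \<inter> e')"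
    using 4 5 6 by simp_all
  have EV: "e \<subseteq> V" "e \<noteq> {}" if "e \<in> E" for e
    using G that unfolding simple_graph_def by auto
  define D where "D X = p ` X \<union> \<Union>((\<lambda>e. path_image (\<gamma> e)) ` {e\<in>E. e \<subseteq> X})" for X
  have pe: "p ` e \<subseteq> path_image (\<gamma> e)" if "e \<in> E" for e
    unfolding ends[OF that, symmetric] by (simp add: pathstart_in_path_image pathfinish_in_path_image)
  have DD: "D X \<inter> D Y = {}" if "X \<subseteq> V" "Y \<subseteq> V" "X \<inter> Y = {}" for X Y
  proof -
    have "p ` X \<inter> p ` Y = {}" using inj_on_image_Int[OF inj that(1,2)] that(3) by simp
    moreover have "p ` X \<inter> path_image (\<gamma> e) = {}" if "e \<in> E" "e \<subseteq> Y" for e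
      using pv[OF that(1)] that \<open>X \<subseteq> V\<close> \<open>X \<inter> Y = {}\<close> by blast
    then have "p ` X \<inter> \<Union>((\<lambda>e. path_image (\<gamma> e)) ` {e\<in>E. e \<subseteq> Y}) = {}"
      by (simp add: Int_UN_distrib)
    moreover have "path_image (\<gamma> e) \<inter> p ` Y = {}" if "e \<in> E" "e \<subseteq> X" for e
      using pv[OF that(1)] that \<open>Y \<subseteq> V\<close> \<open>X \<inter> Y = {}\<close> by blast
    then have "\<Union>((\<lambda>e. path_image (\<gamma> e)) ` {e\<in>E. e \<subseteq> X}) \<inter> p ` Y = {}"
      by blast
    moreover have "path_image (\<gamma> e) \<inter> path_image (\<gamma> e') = {}"
      if "e \<in> E" "e \<subseteq> X" "e' \<in> E" "e' \<subseteq> Y" for e e'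
    proof -
      have "e \<inter> e' = {}" "e \<noteq> e'" using that \<open>X \<inter> Y = {}\<close> EV(2)[OF that(1)] by auto
      then show ?thesis using dis[OF that(1,3)] by auto
    qed
    then have "\<Union>((\<lambda>e. path_image (\<gamma> e)) ` {e\<in>E. e \<subseteq> X}) \<inter> \<Union>((\<lambda>e. path_image (\<gamma> e)) ` {e\<in>E. e \<subseteq> Y}) = {}"
      by blast
    ultimately show ?thesis unfolding D_def by (simp only: Int_Un_distrib Int_Un_distrib2) simp
  qed
  have eD: "path_image (\<gamma> e) \<inter> D X = p ` (e \<inter> X)" if "e \<in> E" "X \<subseteq> V" "\<not> e \<subseteq> X" for e X
  proof
    show "path_image (\<gamma> e) \<inter> D X \<subseteq> p ` (e \<inter> X)"
      unfolding D_def using dis[OF that(1)] pv[OF that(1)] that by blast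
    show "p ` (e \<inter> X) \<subseteq> path_image (\<gamma> e) \<inter> D X"
      using pe[OF that(1)] unfolding D_def by blast
  qed
  have pcD: "path_connected (D X)" if c: "conn_set (adj E) X" for X
  proof -
    obtain a where a: "a \<in> X" using c by (auto simp: conn_set_def)
    have edge: "path_component (D X) u v" if "e \<in> E" "e \<subseteq> X" "u \<in> path_image (\<gamma> e)" "v \<in> path_image (\<gamma> e)" for e u v
    proof -
      have "path_connected (path_image (\<gamma> e))" using arc[OF that(1)] by (simp add: arc_imp_path path_connected_path_image)
      then have "path_component (path_image (\<gamma> e)) u v"
        using that by (simp add: path_connected_component)
      moreover have "path_image (\<gamma> e) \<subseteq> D X" using that unfolding D_def by blast
      ultimately show ?thesis using path_component_of_subset by blast
    qed
    \<comment> \<open>The vertices reached from \<open>a\<close> inside the drawing have no edge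
      leaving them within \<open>X\<close>, so the cut condition makes them all of
      \<open>X\<close>.\<close>
    define Y where "Y = {v\<in>X. path_component (D X) (p a) (p v)}"
    have aY: "a \<in> Y" using a by (auto simp: Y_def D_def path_component_refl)
    have "Y = X"
    proof (rule ccontr)
      assume "Y \<noteq> X"
      moreover have "Y \<subseteq> X" "Y \<noteq> {}" using aY by (auto simp: Y_def)
      ultimately have "\<exists>u\<in>Y. \<exists>v\<in>X - Y. {u,v} \<in> E" using c unfolding conn_set_def by simp
      then obtain u v where uv: "u \<in> Y" "v \<in> X - Y" "{u,v} \<in> E" by blast
      then have "path_component (D X) (p u) (p v)"
        using edge[OF uv(3)] pe[OF uv(3)] by (auto simp: Y_def)
      then have "path_component (D X) (p a) (p v)"
        using uv path_component_trans unfolding Y_def by blast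
      then show False using uv unfolding Y_def by blast
    qed
    then have vert: "path_component (D X) (p a) (p v)" if "v \<in> X" for v using that unfolding Y_def by blast
    have "path_component (D X) (p a) z" if z: "z \<in> D X" for z
    proof (cases "z \<in> p ` X")
      case True then show ?thesis using vert by blast
    next
      case False
      then obtain e where e: "e \<in> E" "e \<subseteq> X" "z \<in> path_image (\<gamma> e)" using z unfolding D_def by blast
      obtain v where v: "v \<in> e" using EV[OF e(1)] by auto
      then have "path_component (D X) (p v) z" using edge[OF e(1,2) _ e(3)] pe[OF e(1)] by blast
      then show ?thesis using vert[of v] v e path_component_trans by blast
    qed
    then show ?thesis unfolding path_connected_component
      by (metis path_component_sym path_component_trans)
  qed
  obtain a b where ab: "\<And>i j. i < 3 \<Longrightarrow> j < 3 \<Longrightarrow> a i j \<in> A i" "\<And>i j. i < 3 \<Longrightarrow> j < 3 \<Longrightarrow> b i j \<in> B j"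
    and abE: "\<And>i j. i < 3 \<Longrightarrow> j < 3 \<Longrightarrow> {a i j, b i j} \<in> E"
    using ex by metis
  define F where "F i j = {a i j, b i j}" for i j
  have FE: "F i j \<in> E" if "i < 3" "j < 3" for i j using abE that by (simp add: F_def)
  have FA: "F i j \<inter> A i = {a i j}" "F i j \<inter> B j = {b i j}" if "i < 3" "j < 3" for i j
    using ab[OF that] AB[OF that] by (auto simp: F_def)
  have FA': "F i j \<inter> A k = {}" if "i < 3" "j < 3" "k < 3" "k \<noteq> i" for i j k
    using ab[of i j] AB[of k j] AA[of k i] that by (auto simp: F_def)
  have FB': "F i j \<inter> B k = {}" if "i < 3" "j < 3" "k < 3" "k \<noteq> j" for i j k
    using ab[of i j] AB[of i k] BB[of k j] that by (auto simp: F_def)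
  have nA: "\<not> F i j \<subseteq> A k" "\<not> F i j \<subseteq> B k" if "i < 3" "j < 3" "k < 3" for i j k
    using ab[of i j] AB[of k j] AB[of i k] that by (auto simp: F_def)
  have FF: "F i j \<inter> F k l \<subseteq> (A i \<inter> A k) \<union> (B j \<inter> B l)" if "i < 3" "j < 3" "k < 3" "l < 3" for i j k l
    using ab[of i j] ab[of k l] AB[of i l] AB[of k j] that unfolding F_def by auto
  have Fne: "F i j \<noteq> F k l" if "i < 3" "j < 3" "k < 3" "l < 3" "i \<noteq> k \<or> j \<noteq> l" for i j k l
    using FA[of i j] FA'[of k l i] FB'[of k l j] that by auto
  have pD: "p ` (X \<inter> Y) \<subseteq> D X \<inter> D Y" for X Y by (auto simp: D_def)
  show False
  proof (rule no_topological_K33[of "\<lambda>i. D (A i)" "\<lambda>i. D (B i)" "\<lambda>i j. path_image (\<gamma> (F i j))" "\<lambda>i j. p (a i j)"])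
    fix i j k l :: nat assume *: "i < 3" "j < 3" "k < 3" "l < 3" "i \<noteq> k \<or> j \<noteq> l"
    have "path_image (\<gamma> (F i j)) \<inter> path_image (\<gamma> (F k l)) \<subseteq> p ` (F i j \<inter> F k l)"
      using * by (intro dis FE Fne)
    also have "\<dots> \<subseteq> p ` ((A i \<inter> A k) \<union> (B j \<inter> B l))" using FF * by blast
    also have "\<dots> \<subseteq> D (A i) \<inter> D (A k) \<union> D (B j) \<inter> D (B l)" using pD by blast
    finally show "path_image (\<gamma> (F i j)) \<inter> path_image (\<gamma> (F k l)) \<subseteq> D (A i) \<inter> D (A k) \<union> D (B j) \<inter> D (B l)" .
  next
    fix i j :: nat assume *: "i < 3" "j < 3"
    show "path_connected (path_image (\<gamma> (F i j))) \<and> compact (path_image (\<gamma> (F i j)))"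
      using arc[OF FE[OF *]] by (simp add: arc_imp_path path_connected_path_image compact_path_image)
    show "D (A i) \<inter> D (B j) = {}" using DD[OF AV BV AB] * by simp
    show "path_image (\<gamma> (F i j)) \<inter> D (A i) = {p (a i j)}" using eD[OF FE AV nA(1)] FA * by simp
    show "path_image (\<gamma> (F i j)) \<inter> D (B j) \<noteq> {}" using eD[OF FE BV nA(2)] FA * by simp
    assume "i \<noteq> j"
    then show "D (A i) \<inter> D (A j) = {}" "D (B i) \<inter> D (B j) = {}"
      using DD[OF AV AV AA] DD[OF BV BV BB] * by simp_all
  next
    fix i j k :: nat assume *: "i < 3" "j < 3" "k < 3"
    show "path_image (\<gamma> (F i j)) \<inter> D (A k) = {}" if "k \<noteq> i" using eD[OF FE AV nA(1)] FA' * that by simp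
    show "path_image (\<gamma> (F i j)) \<inter> D (B k) = {}" if "k \<noteq> j" using eD[OF FE BV nA(2)] FB' * that by simp
  qed (use cA cB pcD in auto)
qed

section \<open>Contraction and edge density without a K_{3,3} minor\<close>

text \<open>Adjacency after contracting disjoint sets to points; \<open>X \<noteq> Y\<close> keeps
  it loop-free. As it is a relation again, contraction can be iterated:
  \<open>quot_adj (quot_adj r)\<close>.\<close>

definition quot_adj :: "('a \<Rightarrow> 'a \<Rightarrow> bool) \<Rightarrow> 'a set \<Rightarrow> 'a set \<Rightarrow> bool" where
  "quot_adj r X Y \<longleftrightarrow> X \<noteq> Y \<and> (\<exists>x\<in>X. \<exists>y\<in>Y. r x y)"

text \<open>For symmetric irreflexive \<open>r\<close> this is twice the number of edges spanned by
  \<open>U\<close>.\<close>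

definition degree_sum :: "('a \<Rightarrow> 'a \<Rightarrow> bool) \<Rightarrow> 'a set \<Rightarrow> nat" where
  "degree_sum r U = (\<Sum>v\<in>U. card {w\<in>U. r v w})"

lemma conn_set_singleton: "conn_set r {v}"
  by (auto simp: conn_set_def)

lemma conn_set_Un:
  assumes "conn_set r X" "conn_set r Y" "quot_adj r X Y" and sym: "\<And>x y. r x y \<Longrightarrow> r y x"
  shows "conn_set r (X \<union> Y)"
  unfolding conn_set_def
proof (intro conjI allI impI)
  show "X \<union> Y \<noteq> {}" using assms by (auto simp: conn_set_def)
  fix Z assume Z: "Z \<subseteq> X \<union> Y \<and> Z \<noteq> {} \<and> Z \<noteq> X \<union> Y"
  have inner: "\<exists>x\<in>Z. \<exists>y\<in>X \<union> Y - Z. r x y" if "conn_set r W" "W \<subseteq> X \<union> Y" "Z \<inter> W \<noteq> {}" "Z \<inter> W \<noteq> W" for W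
  proof -
    have "\<exists>x\<in>Z \<inter> W. \<exists>y\<in>W - Z \<inter> W. r x y" using that unfolding conn_set_def by (meson inf_le2)
    then show ?thesis using that(2) by blast
  qed
  obtain x y where xy: "x \<in> X" "y \<in> Y" "r x y" using assms(3) by (auto simp: quot_adj_def)
  consider "Z \<inter> X \<noteq> {}" "Z \<inter> X \<noteq> X" | "Z \<inter> Y \<noteq> {}" "Z \<inter> Y \<noteq> Y" | "X \<subseteq> Z" "Y \<inter> Z = {}" | "Y \<subseteq> Z" "X \<inter> Z = {}"
    using Z by blast
  then show "\<exists>x\<in>Z. \<exists>y\<in>X \<union> Y - Z. r x y"
  proof cases
    case 1 then show ?thesis using inner[of X] assms by blast
  next
    case 2 then show ?thesis using inner[of Y] assms by blast
  next
    case 3 then show ?thesis using xy by blast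
  next
    case 4 then show ?thesis using xy sym by blast
  qed
qed

text \<open>Undoes the outer level of a twice contracted graph. A cut of the union either splits
  some member, or consists of whole members and is then crossed by an edge between members.\<close>

lemma conn_set_Union:
  assumes S: "conn_set (quot_adj r) S" and c: "\<And>X. X \<in> S \<Longrightarrow> conn_set r X"
  shows "conn_set r (\<Union>S)"
  unfolding conn_set_def
proof (intro conjI allI impI)
  show "\<Union>S \<noteq> {}" using S c by (auto simp: conn_set_def)
  fix Z assume Z: "Z \<subseteq> \<Union>S \<and> Z \<noteq> {} \<and> Z \<noteq> \<Union>S"
  show "\<exists>x\<in>Z. \<exists>y\<in>\<Union>S - Z. r x y"
  proof (cases "\<exists>X\<in>S. Z \<inter> X \<noteq> {} \<and> Z \<inter> X \<noteq> X")
    case True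
    then obtain X where X: "X \<in> S" "Z \<inter> X \<noteq> {}" "Z \<inter> X \<noteq> X" by blast
    then have "\<exists>x\<in>Z \<inter> X. \<exists>y\<in>X - Z \<inter> X. r x y" using c[OF X(1)] unfolding conn_set_def by (meson inf_le2)
    then show ?thesis using X(1) by blast
  next
    case False
    define S1 where "S1 = {X\<in>S. X \<subseteq> Z}"
    have "S1 \<subseteq> S" "S1 \<noteq> {}" "S1 \<noteq> S" using False Z unfolding S1_def by blast+
    then obtain X Y where XY: "X \<in> S1" "Y \<in> S - S1" "quot_adj r X Y"
      using S unfolding conn_set_def by meson
    then have "X \<subseteq> Z" "Y \<inter> Z = {}" using False unfolding S1_def by blast+
    then show ?thesis using XY unfolding quot_adj_def by blast
  qed
qed

lemma degree_sum_insert: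
  assumes "finite R" "u \<notin> R" and sym: "\<And>x y. q x y \<Longrightarrow> q y x" and irr: "\<not> q u u"
  shows "degree_sum q (insert u R) = degree_sum q R + 2 * card {w\<in>R. q u w}"
proof -
  have 1: "{w \<in> insert u R. q u w} = {w\<in>R. q u w}" using irr by auto
  have 2: "card {w \<in> insert u R. q z w} = card {w\<in>R. q z w} + (if q u z then 1 else 0)" if "z \<in> R" for z
  proof (cases "q u z")
    case True
    then have "{w \<in> insert u R. q z w} = insert u {w\<in>R. q z w}" using sym by auto
    then show ?thesis using True assms by simp
  next
    case False
    then have "{w \<in> insert u R. q z w} = {w\<in>R. q z w}" using sym by auto
    then show ?thesis using False by simp
  qed
  have "(\<Sum>z\<in>R. if q u z then 1 else 0) = card {w\<in>R. q u w}"
    using assms(1) by (simp add: sum.If_cases Int_def)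
  then show ?thesis
    using assms(1,2) 1 2 by (simp add: degree_sum_def sum.distrib)
qed

text \<open>Among the minors that keep average degree at least \<open>2s\<close>, one with the fewest branch sets has
  every edge in \<open>s\<close> triangles: contracting an edge costs it and one edge per triangle.\<close>

lemma dense_contraction:
  assumes fin: "finite V" "V \<noteq> {}" and sym: "\<And>x y. r x y \<Longrightarrow> r y x" and irr: "\<And>x. \<not> r x x"
    and dens: "2 * s * card V \<le> degree_sum r V" and s: "s > 0"
  shows "\<exists>P. finite P \<and> (\<forall>X\<in>P. conn_set r X \<and> X \<subseteq> V) \<and> pairwise disjnt P \<and>
    (\<exists>X\<in>P. \<exists>Y\<in>P. quot_adj r X Y) \<and>
    (\<forall>X\<in>P. \<forall>Y\<in>P. quot_adj r X Y \<longrightarrow> s \<le> card {Z\<in>P. quot_adj r X Z \<and> quot_adj r Y Z})"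
proof -
  let ?q = "quot_adj r"
  have qs: "?q X Y \<Longrightarrow> ?q Y X" for X Y using sym by (auto simp: quot_adj_def)
  have qi: "\<not> ?q X X" for X by (simp add: quot_adj_def)
  define good where "good P \<longleftrightarrow> finite P \<and> P \<noteq> {} \<and> (\<forall>X\<in>P. conn_set r X \<and> X \<subseteq> V) \<and> pairwise disjnt P \<and>
    2 * s * card P \<le> degree_sum ?q P" for P
  have "good ((\<lambda>v. {v}) ` V)"
  proof -
    have c: "card ((\<lambda>v. {v}) ` V) = card V" by (simp add: card_image)
    have "degree_sum ?q ((\<lambda>v. {v}) ` V) = (\<Sum>v\<in>V. card {Y \<in> (\<lambda>v. {v}) ` V. ?q {v} Y})"
      unfolding degree_sum_def by (subst sum.reindex) auto
    also have "\<dots> = (\<Sum>v\<in>V. card ((\<lambda>v. {v}) ` {w\<in>V. r v w}))"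
      by (rule sum.cong, simp, rule arg_cong[where f = card]) (use irr in \<open>auto simp: quot_adj_def\<close>)
    also have "\<dots> = degree_sum r V" unfolding degree_sum_def by (simp add: card_image)
    finally show ?thesis
      unfolding good_def using fin dens c by (auto simp: conn_set_singleton pairwise_def)
  qed
  then obtain P where P: "good P" and least: "\<And>P'. good P' \<Longrightarrow> card P \<le> card P'"
    using ex_has_least_nat[of good _ card] by blast
  have PP: "finite P" "P \<noteq> {}" "\<And>X. X \<in> P \<Longrightarrow> conn_set r X" "\<And>X. X \<in> P \<Longrightarrow> X \<subseteq> V" "pairwise disjnt P"
    "2 * s * card P \<le> degree_sum ?q P"
    using P unfolding good_def by auto
  \<comment> \<open>With \<open>s > 0\<close> and \<open>P \<noteq> {}\<close> the required degree
    sum is positive, so an edge survives the contractions.\<close>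
  have edge: "\<exists>X\<in>P. \<exists>Y\<in>P. ?q X Y"
  proof (rule ccontr)
    assume "\<not> ?thesis"
    then have "{Y\<in>P. ?q X Y} = {}" if "X \<in> P" for X using that by blast
    then have "degree_sum ?q P = (\<Sum>X\<in>P. 0)" unfolding degree_sum_def by (intro sum.cong) (simp_all only: card.empty)
    then have "degree_sum ?q P = 0" by simp
    then show False using PP s by auto
  qed
  have tri: "s \<le> card {Z\<in>P. ?q X Z \<and> ?q Y Z}" if XY: "X \<in> P" "Y \<in> P" "?q X Y" for X Y
  proof (rule ccontr)
    assume less: "\<not> ?thesis"
    define R where "R = P - {X, Y}"
    have ne: "X \<noteq> Y" using XY by (auto simp: quot_adj_def)
    have PR: "P = insert X (insert Y R)" using XY by (auto simp: R_def)
    have fR: "finite R" using PP by (simp add: R_def)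
    have nR: "X \<notin> insert Y R" "Y \<notin> R" using ne by (auto simp: R_def)
    have dXR: "Z \<inter> X = {}" "Z \<inter> Y = {}" if "Z \<in> R" for Z
      using PP(5) XY that by (auto simp: R_def pairwise_def disjnt_def)
    have "X \<noteq> {}" using PP(3)[OF XY(1)] by (auto simp: conn_set_def)
    then have UR: "X \<union> Y \<notin> R" using dXR(1)[of "X \<union> Y"] by auto
    let ?NX = "{Z\<in>R. ?q X Z}" and ?NY = "{Z\<in>R. ?q Y Z}"
    have "degree_sum ?q P = degree_sum ?q (insert Y R) + 2 * card {Z\<in>insert Y R. ?q X Z}"
      unfolding PR by (rule degree_sum_insert) (use fR nR qs qi in auto)
    also have "degree_sum ?q (insert Y R) = degree_sum ?q R + 2 * card ?NY"
      by (rule degree_sum_insert) (use fR nR qs qi in auto)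
    also have "{Z\<in>insert Y R. ?q X Z} = insert Y ?NX" using XY by auto
    finally have dP: "degree_sum ?q P = degree_sum ?q R + 2 * card ?NY + 2 * (card ?NX + 1)"
      using fR nR by simp
    have dP': "degree_sum ?q (insert (X \<union> Y) R) = degree_sum ?q R + 2 * card {Z\<in>R. ?q (X \<union> Y) Z}"
      by (rule degree_sum_insert) (use fR UR qs qi in auto)
    have "?q (X \<union> Y) Z \<longleftrightarrow> ?q X Z \<or> ?q Y Z" if "Z \<in> R" for Z
      using that UR nR unfolding quot_adj_def by blast
    then have "{Z\<in>R. ?q (X \<union> Y) Z} = ?NX \<union> ?NY" by blast
    moreover have "{Z\<in>P. ?q X Z \<and> ?q Y Z} = ?NX \<inter> ?NY" using qi by (auto simp: R_def)
    moreover have "card ?NX + card ?NY = card (?NX \<union> ?NY) + card (?NX \<inter> ?NY)"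
      using fR by (intro card_Un_Int) auto
    \<comment> \<open>Fewer than \<open>s\<close> common neighbours make the degree sum fall by at
      most \<open>2 * s\<close>, exactly the allowance freed by having one set fewer. The merged
      family is therefore good again, against minimality.\<close>
    ultimately have d: "degree_sum ?q P \<le> degree_sum ?q (insert (X \<union> Y) R) + 2 * s"
      using dP dP' less by simp
    have cP: "card P = card (insert (X \<union> Y) R) + 1" using PR fR nR UR by simp
    have "good (insert (X \<union> Y) R)"
      unfolding good_def
    proof (intro conjI)
      show "\<forall>Z\<in>insert (X \<union> Y) R. conn_set r Z \<and> Z \<subseteq> V"
        using conn_set_Un[OF PP(3)[OF XY(1)] PP(3)[OF XY(2)] XY(3) sym] PP(3,4) XY by (auto simp: R_def)
      show "pairwise disjnt (insert (X \<union> Y) R)"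
      proof -
        have "pairwise disjnt R" using PP(5) by (rule pairwise_subset) (auto simp: R_def)
        moreover have "disjnt (X \<union> Y) Z \<and> disjnt Z (X \<union> Y)" if "Z \<in> R" for Z
          using dXR[OF that] unfolding disjnt_def by (simp add: Int_Un_distrib Int_Un_distrib2 Int_commute)
        ultimately show ?thesis unfolding pairwise_insert by blast
      qed
      have "2 * s * card P = 2 * s * card (insert (X \<union> Y) R) + 2 * s" using cP by simp
      then show "2 * s * card (insert (X \<union> Y) R) \<le> degree_sum ?q (insert (X \<union> Y) R)"
        using PP(6) d by linarith
    qed (use fR in auto)
    from least[OF this] show False using cP by simp
  qed
  show ?thesis by (intro exI[of _ P] conjI ballI impI) (simp_all add: PP edge tri)
qed

text \<open>Contract twice. Degree sum \<open>12 * card U\<close> yields a minor whose edges all lie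
  in 6 triangles, so the neighbourhood of a branch set \<open>X\<close> has minimum degree 6.
  Contracting inside that neighbourhood with \<open>s = 3\<close> gives adjacent \<open>S\<close>,
  \<open>T\<close> with three common neighbours; as \<open>X\<close> is adjacent to everything
  there, \<open>S\<close>, \<open>T\<close>, \<open>X\<close> face these three in a K_{3,3}
  minor.\<close>

lemma no_K33_minor_sparse:
  assumes no: "\<not> K33_minor r V" and fin: "finite U" "U \<noteq> {}" "U \<subseteq> V"
    and sym: "\<And>x y. r x y \<Longrightarrow> r y x" and irr: "\<And>x. \<not> r x x"
  shows "degree_sum r U < 12 * card U"
proof (rule ccontr)
  assume "\<not> ?thesis"
  then have d: "2 * 6 * card U \<le> degree_sum r U" by simp
  have "\<exists>P. finite P \<and> (\<forall>X\<in>P. conn_set r X \<and> X \<subseteq> U) \<and> pairwise disjnt P \<and>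
    (\<exists>X\<in>P. \<exists>Y\<in>P. quot_adj r X Y) \<and>
    (\<forall>X\<in>P. \<forall>Y\<in>P. quot_adj r X Y \<longrightarrow> 6 \<le> card {Z\<in>P. quot_adj r X Z \<and> quot_adj r Y Z})"
    by (rule dense_contraction) (use fin sym irr d in auto)
  then obtain P where P0: "finite P" "\<forall>X\<in>P. conn_set r X \<and> X \<subseteq> U" "pairwise disjnt P"
    "\<exists>X\<in>P. \<exists>Y\<in>P. quot_adj r X Y"
    "\<forall>X\<in>P. \<forall>Y\<in>P. quot_adj r X Y \<longrightarrow> 6 \<le> card {Z\<in>P. quot_adj r X Z \<and> quot_adj r Y Z}"
    by (elim exE conjE)
  have P: "finite P" "\<And>X. X \<in> P \<Longrightarrow> conn_set r X" "\<And>X. X \<in> P \<Longrightarrow> X \<subseteq> U" "pairwise disjnt P"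
    "\<exists>X\<in>P. \<exists>Y\<in>P. quot_adj r X Y"
    "\<And>X Y. X \<in> P \<Longrightarrow> Y \<in> P \<Longrightarrow> quot_adj r X Y \<Longrightarrow> 6 \<le> card {Z\<in>P. quot_adj r X Z \<and> quot_adj r Y Z}"
    using P0 by blast+
  let ?q = "quot_adj r"
  have qs: "?q X Y \<Longrightarrow> ?q Y X" for X Y using sym by (auto simp: quot_adj_def)
  have qi: "\<not> ?q X X" for X by (simp add: quot_adj_def)
  obtain X where X: "X \<in> P" "\<exists>Y\<in>P. ?q X Y" using P(5) by blast
  define N where "N = {Z\<in>P. ?q X Z}"
  have N: "finite N" "N \<noteq> {}" "N \<subseteq> P" "X \<notin> N" using X P(1) qi by (auto simp: N_def)
  have "(\<Sum>Z\<in>N. 6) \<le> degree_sum ?q N"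
    unfolding degree_sum_def
  proof (rule sum_mono)
    fix Z assume "Z \<in> N"
    then have "6 \<le> card {W\<in>P. ?q X W \<and> ?q Z W}" using P(6)[OF X(1)] by (auto simp: N_def)
    also have "{W\<in>P. ?q X W \<and> ?q Z W} = {W\<in>N. ?q Z W}" by (auto simp: N_def)
    finally show "6 \<le> card {W\<in>N. ?q Z W}" .
  qed
  then have d': "2 * 3 * card N \<le> degree_sum ?q N" by simp
  have "\<exists>P. finite P \<and> (\<forall>X\<in>P. conn_set ?q X \<and> X \<subseteq> N) \<and> pairwise disjnt P \<and>
    (\<exists>X\<in>P. \<exists>Y\<in>P. quot_adj ?q X Y) \<and>
    (\<forall>X\<in>P. \<forall>Y\<in>P. quot_adj ?q X Y \<longrightarrow> 3 \<le> card {Z\<in>P. quot_adj ?q X Z \<and> quot_adj ?q Y Z})"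
    by (rule dense_contraction) (use N qs qi d' in auto)
  then obtain Q where Q0: "finite Q" "\<forall>X\<in>Q. conn_set ?q X \<and> X \<subseteq> N" "pairwise disjnt Q"
    "\<exists>X\<in>Q. \<exists>Y\<in>Q. quot_adj ?q X Y"
    "\<forall>X\<in>Q. \<forall>Y\<in>Q. quot_adj ?q X Y \<longrightarrow> 3 \<le> card {Z\<in>Q. quot_adj ?q X Z \<and> quot_adj ?q Y Z}"
    by (elim exE conjE)
  have Q: "finite Q" "\<And>X. X \<in> Q \<Longrightarrow> conn_set ?q X" "\<And>X. X \<in> Q \<Longrightarrow> X \<subseteq> N" "pairwise disjnt Q"
    "\<exists>X\<in>Q. \<exists>Y\<in>Q. quot_adj ?q X Y"
    "\<And>X Y. X \<in> Q \<Longrightarrow> Y \<in> Q \<Longrightarrow> quot_adj ?q X Y \<Longrightarrow> 3 \<le> card {Z\<in>Q. quot_adj ?q X Z \<and> quot_adj ?q Y Z}"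
    using Q0 by blast+
  obtain S T where ST: "S \<in> Q" "T \<in> Q" "quot_adj ?q S T" using Q(5) by blast
  obtain C where C: "C \<subseteq> {Z\<in>Q. quot_adj ?q S Z \<and> quot_adj ?q T Z}" "card C = 3" "finite C"
    by (rule obtain_subset_with_card_n[OF Q(6)[OF ST]])
  obtain f where f: "bij_betw f {0..<3::nat} C" using ex_bij_betw_nat_finite[OF C(3)] C(2) by auto
  have fC: "f i \<in> Q" "quot_adj ?q S (f i)" "quot_adj ?q T (f i)" if "i < 3" for i
    using bij_betwE[OF f] C(1) that by auto
  have fi: "f i \<noteq> f j" if "i < 3" "j < 3" "i \<noteq> j" for i j
    using f that by (auto simp: bij_betw_def inj_on_def)
  have QU: "conn_set r (\<Union>Z)" "\<Union>Z \<subseteq> V" "\<Union>Z \<inter> X = {}" "\<exists>x\<in>X. \<exists>y\<in>\<Union>Z. r x y" if Z: "Z \<in> Q" for Z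
  proof -
    have ZP: "Z \<subseteq> P" using Q(3)[OF Z] N(3) by auto
    show "conn_set r (\<Union>Z)" by (rule conn_set_Union[OF Q(2)[OF Z]]) (use ZP P(2) in auto)
    show "\<Union>Z \<subseteq> V" using ZP P(3) fin(3) by blast
    have "W \<inter> X = {}" if "W \<in> Z" for W
    proof -
      have "W \<in> P" "W \<noteq> X" using that Q(3)[OF Z] N(3,4) by auto
      then show ?thesis using P(4) X(1) by (simp add: pairwise_def disjnt_def)
    qed
    then show "\<Union>Z \<inter> X = {}" by blast
    obtain W where W: "W \<in> Z" using Q(2)[OF Z] by (auto simp: conn_set_def)
    then have "?q X W" using Q(3)[OF Z] by (auto simp: N_def)
    then show "\<exists>x\<in>X. \<exists>y\<in>\<Union>Z. r x y" using W by (auto simp: quot_adj_def)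
  qed
  have dQ: "\<Union>Y \<inter> \<Union>Z = {}" if "Y \<in> Q" "Z \<in> Q" "Y \<noteq> Z" for Y Z
  proof -
    have "Y \<inter> Z = {}" using Q(4) that by (auto simp: pairwise_def disjnt_def)
    moreover have "Y \<subseteq> P" "Z \<subseteq> P" using Q(3) N(3) that by blast+
    ultimately have "W \<inter> W' = {}" if "W \<in> Y" "W' \<in> Z" for W W'
      using P(4) that unfolding pairwise_def disjnt_def by (metis disjoint_iff subsetD)
    then show ?thesis by blast
  qed
  have eQ: "\<exists>x\<in>\<Union>Y. \<exists>y\<in>\<Union>Z. r x y" if "quot_adj ?q Y Z" for Y Z
    using that unfolding quot_adj_def by blast
  have SX: "conn_set r X" "X \<subseteq> V" using P(2,3) X fin(3) by blast+
  have Sf: "\<Union>S \<inter> \<Union>(f j) = {}" "\<Union>T \<inter> \<Union>(f j) = {}" "X \<inter> \<Union>(f j) = {}" if "j < 3" for j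
    using dQ[OF ST(1) fC(1)[OF that]] dQ[OF ST(2) fC(1)[OF that]] fC[OF that] QU(3)[OF fC(1)[OF that]]
    by (auto simp: quot_adj_def)
  have STd: "\<Union>S \<inter> \<Union>T = {}" using dQ[OF ST(1,2)] ST(3) by (simp add: quot_adj_def)
  have lt3: "i < 3 \<longleftrightarrow> i = 0 \<or> i = 1 \<or> i = 2" for i :: nat by auto
  let ?A = "\<lambda>i::nat. if i = 0 then \<Union>S else if i = 1 then \<Union>T else X"
  have c1: "\<forall>i<3. conn_set r (?A i) \<and> ?A i \<subseteq> V \<and> conn_set r (\<Union>(f i)) \<and> \<Union>(f i) \<subseteq> V"
    using QU(1,2)[OF ST(1)] QU(1,2)[OF ST(2)] SX QU(1,2)[OF fC(1)] by simp
  have c2: "\<forall>i<3. \<forall>j<3. i \<noteq> j \<longrightarrow> ?A i \<inter> ?A j = {} \<and> \<Union>(f i) \<inter> \<Union>(f j) = {}"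
  proof (intro allI impI conjI)
    fix i j :: nat assume ij: "i < 3" "j < 3" "i \<noteq> j"
    have "X \<inter> \<Union>S = {}" "X \<inter> \<Union>T = {}" "\<Union>T \<inter> \<Union>S = {}"
      using STd QU(3)[OF ST(1)] QU(3)[OF ST(2)] by (simp_all only: Int_commute)
    then show "?A i \<inter> ?A j = {}"
      using ij STd QU(3)[OF ST(1)] QU(3)[OF ST(2)] unfolding lt3 by (elim disjE) simp_all
    show "\<Union>(f i) \<inter> \<Union>(f j) = {}" using dQ[OF fC(1) fC(1) fi] ij by simp
  qed
  have c3: "\<forall>i<3. \<forall>j<3. ?A i \<inter> \<Union>(f j) = {} \<and> (\<exists>x\<in>?A i. \<exists>y\<in>\<Union>(f j). r x y)"
  proof (intro allI impI conjI)
    fix i j :: nat assume ij: "i < 3" "j < 3"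
    show "?A i \<inter> \<Union>(f j) = {}" using Sf[OF ij(2)] by simp
    show "\<exists>x\<in>?A i. \<exists>y\<in>\<Union>(f j). r x y"
      using eQ[OF fC(2)[OF ij(2)]] eQ[OF fC(3)[OF ij(2)]] QU(4)[OF fC(1)[OF ij(2)]] by simp
  qed
  have "K33_minor r V"
    unfolding K33_minor_def by (rule exI[of _ ?A], rule exI[of _ "\<lambda>j. \<Union>(f j)"]) (intro conjI c1 c2 c3)
  then show False using no by simp
qed

section \<open>Spectral radius and Rayleigh quotients\<close>

abbreviation nbrs :: "'a set \<Rightarrow> 'a set set \<Rightarrow> 'a \<Rightarrow> 'a set" where
  "nbrs V E v \<equiv> {w\<in>V. {v, w} \<in> E}"

text \<open>The bilinear form of the adjacency matrix, summed over ordered pairs, so an edge enters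
  twice.\<close>

definition adj_form :: "'a set \<Rightarrow> 'a set set \<Rightarrow> ('a \<Rightarrow> real) \<Rightarrow> ('a \<Rightarrow> real) \<Rightarrow> real" where
  "adj_form V E x y = (\<Sum>v\<in>V. \<Sum>w\<in>nbrs V E v. x v * y w)"

lemma sum_nbrs_swap:
  fixes f :: "'a \<Rightarrow> 'a \<Rightarrow> 'b::comm_monoid_add"
  assumes "finite V"
  shows "(\<Sum>v\<in>V. \<Sum>w\<in>nbrs V E v. f v w) = (\<Sum>v\<in>V. \<Sum>w\<in>nbrs V E v. f w v)"
proof -
  have "(\<Sum>v\<in>V. \<Sum>w\<in>nbrs V E v. f v w) = (\<Sum>v\<in>V. \<Sum>w\<in>V. if {v, w} \<in> E then f v w else 0)"
    using assms by (simp add: sum.inter_filter)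
  also have "\<dots> = (\<Sum>w\<in>V. \<Sum>v\<in>V. if {v, w} \<in> E then f v w else 0)"
    by (rule sum.swap)
  also have "\<dots> = (\<Sum>w\<in>V. \<Sum>v\<in>V. if {w, v} \<in> E then f v w else 0)"
    by (simp add: insert_commute)
  also have "\<dots> = (\<Sum>v\<in>V. \<Sum>w\<in>nbrs V E v. f w v)"
    using assms by (simp add: sum.inter_filter)
  finally show ?thesis .
qed

lemma adj_form_commute:
  assumes "finite V" shows "adj_form V E x y = adj_form V E y x"
  unfolding adj_form_def using sum_nbrs_swap[OF assms, where E = E and f = "\<lambda>v w. x v * y w"] by (simp add: mult.commute)

lemma adj_form_eq: "adj_form V E x y = (\<Sum>v\<in>V. x v * (\<Sum>w\<in>nbrs V E v. y w))"
  by (simp add: adj_form_def sum_distrib_left)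

lemma adj_form_add_left: "adj_form V E (\<lambda>v. x v + t * z v) y = adj_form V E x y + t * adj_form V E z y"
  by (simp add: adj_form_def sum.distrib sum_distrib_left distrib_right mult.assoc)

lemma adj_form_add_right: "adj_form V E y (\<lambda>v. x v + t * z v) = adj_form V E y x + t * adj_form V E y z"
  by (simp add: adj_form_def sum.distrib sum_distrib_left algebra_simps)

text \<open>Compactness yields a maximiser among nonnegative unit vectors. It serves all vectors,
  because taking absolute values does not decrease the form and rescaling keeps the
  quotient.\<close>

lemma adj_form_maximizer:
  assumes fin: "finite V" "V \<noteq> {}"
  shows "\<exists>x l::real. (\<forall>v. 0 \<le> x v) \<and> (\<Sum>v\<in>V. (x v)\<^sup>2) = 1 \<and> adj_form V E x x = l \<and>
    (\<forall>y. adj_form V E y y \<le> l * (\<Sum>v\<in>V. (y v)\<^sup>2))"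
proof -
  let ?n = "\<lambda>x::'a \<Rightarrow> real. \<Sum>v\<in>V. (x v)\<^sup>2"
  \<comment> \<open>Coordinates outside \<open>V\<close> are pinned to 0, which makes the box
    compact in the product topology even when the vertex type is infinite.\<close>
  define B where "B = (PiE UNIV (\<lambda>v. if v \<in> V then {0..1::real} else {0}))"
  define K where "K = B \<inter> {x. ?n x = 1}"
  have cc: "continuous_on UNIV (\<lambda>x::'a \<Rightarrow> real. x v)" for v by simp
  have "compactin (product_topology (\<lambda>i. euclidean) UNIV) B"
    unfolding B_def by (subst compactin_PiE) auto
  then have "compact B" by (simp add: euclidean_product_topology)
  moreover have "closed {x. ?n x = 1}"
    by (intro closed_Collect_eq continuous_on_sum continuous_on_power cc continuous_on_const)
  ultimately have "compact K" unfolding K_def by (rule compact_Int_closed)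
  moreover have "K \<noteq> {}"
  proof -
    obtain a where a: "a \<in> V" using fin by auto
    have "(\<Sum>v\<in>V. (if v = a then 1 else 0 :: real)\<^sup>2) = (\<Sum>v\<in>V. if v = a then 1 else 0)"
      by (rule sum.cong) auto
    also have "\<dots> = 1" using a fin by simp
    finally have "(\<lambda>v. if v = a then 1 else 0) \<in> K" using a by (auto simp: K_def B_def)
    then show ?thesis by blast
  qed
  moreover have "continuous_on K (\<lambda>x. adj_form V E x x)"
    unfolding adj_form_def
    by (rule continuous_on_subset[OF _ subset_UNIV]) (intro continuous_on_sum continuous_on_mult cc)
  ultimately obtain x where x: "x \<in> K" and max: "\<And>y. y \<in> K \<Longrightarrow> adj_form V E y y \<le> adj_form V E x x"
    using continuous_attains_sup[of K "\<lambda>x. adj_form V E x x"] by blast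
  have x0: "0 \<le> x v" for v
  proof -
    have "x v \<in> (if v \<in> V then {0..1::real} else {0})" using x unfolding K_def B_def by (auto simp: PiE_def Pi_def)
    then show ?thesis by (auto split: if_splits)
  qed
  have "adj_form V E y y \<le> adj_form V E x x * ?n y" for y
  proof (cases "?n y = 0")
    case True
    then have "y v = 0" if "v \<in> V" for v using that fin by (simp add: sum_nonneg_eq_0_iff)
    then have "adj_form V E y y = 0" unfolding adj_form_def by simp
    then show ?thesis using True by simp
  next
    case False
    define N where "N = ?n y"
    have N: "N > 0" using False sum_nonneg[of V "\<lambda>v. (y v)\<^sup>2"] unfolding N_def by (simp add: less_le)
    define z where "z v = (if v \<in> V then \<bar>y v\<bar> / sqrt N else 0)" for v
    have zN: "(z v)\<^sup>2 = (y v)\<^sup>2 / N" if "v \<in> V" for v using that N by (simp add: z_def power_divide)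
    have "?n z = ?n y / N" using zN by (simp add: sum_divide_distrib)
    then have n1: "?n z = 1" using N N_def by simp
    have "z v \<le> 1" if "v \<in> V" for v
    proof -
      have "(z v)\<^sup>2 \<le> ?n z" using that fin by (intro member_le_sum) auto
      then show ?thesis using n1 by (simp add: abs_square_le_1)
    qed
    then have "z \<in> K" using n1 N by (auto simp: K_def B_def z_def)
    then have le: "adj_form V E z z \<le> adj_form V E x x" by (rule max)
    have "adj_form V E y y \<le> (\<Sum>v\<in>V. \<Sum>w\<in>nbrs V E v. \<bar>y v\<bar> * \<bar>y w\<bar>)"
      unfolding adj_form_def by (intro sum_mono) (metis abs_ge_self abs_mult)
    also have "\<dots> = (\<Sum>v\<in>V. \<Sum>w\<in>nbrs V E v. N * (z v * z w))"
      by (intro sum.cong refl) (use N in \<open>auto simp: z_def field_simps\<close>)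
    also have "\<dots> = N * adj_form V E z z" by (simp add: adj_form_def sum_distrib_left)
    also have "\<dots> \<le> N * adj_form V E x x" using le N by simp
    finally show ?thesis by (simp add: N_def mult.commute)
  qed
  then show ?thesis using x x0 unfolding K_def by blast
qed

text \<open>First variation in the direction of a unit vector:
  \<open>2 * t * c + t\<^sup>2 * d\<close> is nonnegative for every \<open>t\<close>, so its linear
  coefficient vanishes. This gives the Perron vector and, later, the equality case for the hub
  graph.\<close>

lemma adj_form_extremal_eigenvector:
  assumes fin: "finite V" and ray: "\<And>y. adj_form V E y y \<le> l * (\<Sum>v\<in>V. (y v)\<^sup>2)"
    and eq: "adj_form V E x x = l * (\<Sum>v\<in>V. (x v)\<^sup>2)" and u: "u \<in> V"
  shows "(\<Sum>w\<in>nbrs V E u. x w) = l * x u"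
proof -
  define z where "z v = (if v = u then 1 else 0 :: real)" for v
  define c where "c = l * x u - (\<Sum>w\<in>nbrs V E u. x w)"
  define d where "d = l * (\<Sum>v\<in>V. (z v)\<^sup>2) - adj_form V E z z"
  have d: "d \<ge> 0" using ray[of z] by (simp add: d_def)
  have zx: "adj_form V E z x = (\<Sum>w\<in>nbrs V E u. x w)"
    unfolding adj_form_eq z_def using fin u by (simp add: if_distrib[of "\<lambda>t. t * _"] cong: if_cong)
  have xz: "(\<Sum>v\<in>V. x v * z v) = x u"
    unfolding z_def using fin u by (simp add: if_distrib[of "\<lambda>t. _ * t"] cong: if_cong)
  have pos: "0 \<le> 2 * t * c + t\<^sup>2 * d" for t
  proof -
    have "adj_form V E (\<lambda>v. x v + t * z v) (\<lambda>v. x v + t * z v) =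
        adj_form V E x x + 2 * t * adj_form V E z x + t\<^sup>2 * adj_form V E z z"
      unfolding adj_form_add_left adj_form_add_right adj_form_commute[OF fin, of E x z]
      by (simp add: algebra_simps power2_eq_square)
    moreover have "(\<Sum>v\<in>V. (x v + t * z v)\<^sup>2) = (\<Sum>v\<in>V. (x v)\<^sup>2) + 2 * t * (\<Sum>v\<in>V. x v * z v) + t\<^sup>2 * (\<Sum>v\<in>V. (z v)\<^sup>2)"
      by (simp add: power2_sum sum.distrib sum_distrib_left power_mult_distrib algebra_simps)
    ultimately show ?thesis
      using ray[of "\<lambda>v. x v + t * z v"] eq unfolding zx xz c_def d_def by (simp add: algebra_simps)
  qed
  have "c = 0"
  proof (rule ccontr)
    assume "c \<noteq> 0"
    define e where "e = d + 1"
    have e: "e > 0" "d = e - 1" using d by (auto simp: e_def)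
    \<comment> \<open>The test value of \<open>t\<close> has denominator \<open>d + 1\<close> since
      \<open>d\<close> may be 0.\<close>
    have "2 * (- c / (d + 1)) * c + (- c / (d + 1))\<^sup>2 * d = - (c\<^sup>2 * (d + 2) / (d + 1)\<^sup>2)"
      unfolding e(2) using e(1) by (simp add: divide_simps power2_eq_square) (simp add: algebra_simps)
    moreover have "c\<^sup>2 * (d + 2) / (d + 1)\<^sup>2 > 0" using d \<open>c \<noteq> 0\<close> by simp
    ultimately show False using pos[of "- c / (d + 1)"] by simp
  qed
  then show ?thesis by (simp add: c_def)
qed

section \<open>Reality and finiteness of the spectrum\<close>

text \<open>Moving the symmetric matrix from one factor to the other turns \<open>\<mu>\<close> into
  \<open>cnj \<nu>\<close>. With \<open>x = y\<close> it proves eigenvalues real; for distinct real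
  eigenvalues it is orthogonality.\<close>

lemma adj_eigenvalue_orthogonal:
  fixes x y :: "'a \<Rightarrow> complex"
  assumes fin: "finite V"
    and x: "\<And>v. v \<in> V \<Longrightarrow> (\<Sum>w\<in>nbrs V E v. x w) = \<mu> * x v"
    and y: "\<And>v. v \<in> V \<Longrightarrow> (\<Sum>w\<in>nbrs V E v. y w) = \<nu> * y v"
    and ne: "\<mu> \<noteq> cnj \<nu>"
  shows "(\<Sum>v\<in>V. x v * cnj (y v)) = 0"
proof -
  have "\<mu> * (\<Sum>v\<in>V. x v * cnj (y v)) = (\<Sum>v\<in>V. \<Sum>w\<in>nbrs V E v. x w * cnj (y v))"
    using x by (simp add: sum_distrib_left sum_distrib_right[symmetric] mult.assoc[symmetric])
  also have "\<dots> = (\<Sum>v\<in>V. \<Sum>w\<in>nbrs V E v. x v * cnj (y w))"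
    by (rule sum_nbrs_swap[OF fin])
  also have "\<dots> = (\<Sum>v\<in>V. x v * cnj (\<nu> * y v))"
    by (intro sum.cong refl) (simp only: y[symmetric] cnj_sum sum_distrib_left)
  also have "\<dots> = cnj \<nu> * (\<Sum>v\<in>V. x v * cnj (y v))"
    by (simp add: sum_distrib_left algebra_simps)
  finally show ?thesis using ne by simp
qed

lemma adj_eigenvalue_real_eigenvector:
  assumes fin: "finite V" and ev: "adj_eigenvalue V E \<mu>"
  shows "\<exists>x::'a \<Rightarrow> real. (\<Sum>v\<in>V. (x v)\<^sup>2) = 1 \<and> (\<forall>v\<in>V. (\<Sum>w\<in>nbrs V E v. complex_of_real (x w)) = \<mu> * x v) \<and> cnj \<mu> = \<mu>"
proof -
  obtain z :: "'a \<Rightarrow> complex" where "\<exists>v\<in>V. z v \<noteq> 0" "\<forall>v\<in>V. (\<Sum>w\<in>nbrs V E v. z w) = \<mu> * z v"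
    using ev unfolding adj_eigenvalue_def by (elim exE conjE)
  then have z: "\<exists>v\<in>V. z v \<noteq> 0" "\<And>v. v \<in> V \<Longrightarrow> (\<Sum>w\<in>nbrs V E v. z w) = \<mu> * z v" by simp_all
  have real: "\<mu> = cnj \<mu>"
  proof (rule ccontr)
    assume "\<mu> \<noteq> cnj \<mu>"
    then have "(\<Sum>v\<in>V. z v * cnj (z v)) = 0" by (intro adj_eigenvalue_orthogonal[OF fin z(2) z(2)])
    then have "complex_of_real (\<Sum>v\<in>V. (cmod (z v))\<^sup>2) = 0"
      unfolding of_real_sum complex_norm_square .
    then have "(\<Sum>v\<in>V. (cmod (z v))\<^sup>2) = 0" by (simp only: of_real_eq_0_iff)
    then show False using z(1) fin by (simp add: sum_nonneg_eq_0_iff)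
  qed
  then obtain m where m: "\<mu> = complex_of_real m" by (metis Reals_cnj_iff Reals_cases)
  \<comment> \<open>Matrix and eigenvalue are real, so real and imaginary part of \<open>z\<close>
    both satisfy the equation, and one of them is nonzero on \<open>V\<close>.\<close>
  obtain y :: "'a \<Rightarrow> real" where y: "\<exists>v\<in>V. y v \<noteq> 0" "\<And>v. v \<in> V \<Longrightarrow> (\<Sum>w\<in>nbrs V E v. y w) = m * y v"
  proof (cases "\<exists>v\<in>V. Re (z v) \<noteq> 0")
    case True
    show ?thesis
    proof (rule that[of "\<lambda>v. Re (z v)"])
      show "(\<Sum>w\<in>nbrs V E v. Re (z w)) = m * Re (z v)" if "v \<in> V" for v
        using arg_cong[OF z(2)[OF that], of Re] by (simp add: m)
    qed (use True in auto)
  next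
    case False
    show ?thesis
    proof (rule that[of "\<lambda>v. Im (z v)"])
      show "(\<Sum>w\<in>nbrs V E v. Im (z w)) = m * Im (z v)" if "v \<in> V" for v
        using arg_cong[OF z(2)[OF that], of Im] by (simp add: m)
    qed (use False z(1) in \<open>auto simp: complex_eq_iff\<close>)
  qed
  define N where "N = (\<Sum>v\<in>V. (y v)\<^sup>2)"
  have "N \<ge> 0" by (simp add: N_def sum_nonneg)
  moreover have "N \<noteq> 0" using y(1) fin by (simp add: N_def sum_nonneg_eq_0_iff)
  ultimately have N: "N > 0" by simp
  have "(\<Sum>v\<in>V. (y v / sqrt N)\<^sup>2) = 1"
    using N by (simp add: power_divide sum_divide_distrib[symmetric] N_def[symmetric])
  moreover have "(\<Sum>w\<in>nbrs V E v. complex_of_real (y w / sqrt N)) = \<mu> * complex_of_real (y v / sqrt N)" if "v \<in> V" for v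
  proof -
    have "(\<Sum>w\<in>nbrs V E v. y w / sqrt N) = m * (y v / sqrt N)"
      using y(2)[OF that] by (simp add: sum_divide_distrib[symmetric])
    then show ?thesis unfolding m of_real_sum[symmetric] of_real_mult[symmetric] by simp
  qed
  ultimately show ?thesis using real by (intro exI[of _ "\<lambda>v. y v / sqrt N"]) simp
qed

text \<open>Bessel's inequality bounds the number of eigenvalues by the number of vertices.\<close>

lemma finite_adj_eigenvalues:
  assumes fin: "finite V"
  shows "finite {\<mu>. adj_eigenvalue V E \<mu>}"
proof (rule conjunct1[OF finite_if_finite_subsets_card_bdd[where C = "card V"]])
  fix M assume M: "M \<subseteq> {\<mu>. adj_eigenvalue V E \<mu>}" "finite M"
  then have "\<forall>\<mu>\<in>M. \<exists>x::'a \<Rightarrow> real. (\<Sum>v\<in>V. (x v)\<^sup>2) = 1 \<and>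
      (\<forall>v\<in>V. (\<Sum>w\<in>nbrs V E v. complex_of_real (x w)) = \<mu> * x v) \<and> cnj \<mu> = \<mu>"
    using adj_eigenvalue_real_eigenvector[OF fin] by blast
  from bchoice[OF this] obtain u :: "complex \<Rightarrow> 'a \<Rightarrow> real" where u0: "\<forall>\<mu>\<in>M. (\<Sum>v\<in>V. (u \<mu> v)\<^sup>2) = 1 \<and>
      (\<forall>v\<in>V. (\<Sum>w\<in>nbrs V E v. complex_of_real (u \<mu> w)) = \<mu> * u \<mu> v) \<and> cnj \<mu> = \<mu>" ..
  then have u: "\<And>\<mu>. \<mu> \<in> M \<Longrightarrow> (\<Sum>v\<in>V. (u \<mu> v)\<^sup>2) = 1"
    "\<And>\<mu> v. \<mu> \<in> M \<Longrightarrow> v \<in> V \<Longrightarrow> (\<Sum>w\<in>nbrs V E v. complex_of_real (u \<mu> w)) = \<mu> * u \<mu> v"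
    "\<And>\<mu>. \<mu> \<in> M \<Longrightarrow> cnj \<mu> = \<mu>"
    by auto
  have orth: "(\<Sum>v\<in>V. u \<mu> v * u \<nu> v) = (if \<mu> = \<nu> then 1 else 0)" if "\<mu> \<in> M" "\<nu> \<in> M" for \<mu> \<nu>
  proof (cases "\<mu> = \<nu>")
    case True then show ?thesis using u(1)[OF that(1)] by (simp add: power2_eq_square)
  next
    case False
    then have "(\<Sum>v\<in>V. complex_of_real (u \<mu> v) * cnj (complex_of_real (u \<nu> v))) = 0"
      using u that by (intro adj_eigenvalue_orthogonal[OF fin, where E = E and \<mu> = \<mu> and \<nu> = \<nu>]) auto
    then have "complex_of_real (\<Sum>v\<in>V. u \<mu> v * u \<nu> v) = 0" by simp
    then show ?thesis using False by (simp only: of_real_eq_0_iff if_False)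
  qed
  \<comment> \<open>Bessel for the unit vector at \<open>v\<close>: \<open>s\<close> is its
    projection onto the span of the eigenvectors. Summing over \<open>v\<close> gives
    \<open>card M \<le> card V\<close>.\<close>
  have bessel: "(\<Sum>\<mu>\<in>M. (u \<mu> v)\<^sup>2) \<le> 1" if v: "v \<in> V" for v
  proof -
    define \<delta> where "\<delta> w = (if w = v then 1 else 0 :: real)" for w
    define s where "s w = (\<Sum>\<mu>\<in>M. u \<mu> v * u \<mu> w)" for w
    have 1: "(\<Sum>w\<in>V. (\<delta> w)\<^sup>2) = 1"
    proof -
      have "(\<Sum>w\<in>V. (\<delta> w)\<^sup>2) = (\<Sum>w\<in>V. if w = v then 1 else 0)" by (rule sum.cong) (auto simp: \<delta>_def)
      then show ?thesis using v fin by simp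
    qed
    have "(\<Sum>w\<in>V. \<delta> w * s w) = (\<Sum>w\<in>V. if w = v then s w else 0)" by (rule sum.cong) (auto simp: \<delta>_def)
    then have 2: "(\<Sum>w\<in>V. \<delta> w * s w) = s v" using v fin by simp
    have sv: "s v = (\<Sum>\<mu>\<in>M. (u \<mu> v)\<^sup>2)" by (simp add: s_def power2_eq_square)
    have "(\<Sum>w\<in>V. (s w)\<^sup>2) = (\<Sum>w\<in>V. \<Sum>\<mu>\<in>M. \<Sum>\<nu>\<in>M. (u \<mu> v * u \<nu> v) * (u \<mu> w * u \<nu> w))"
      by (simp add: s_def power2_eq_square sum_product algebra_simps)
    also have "\<dots> = (\<Sum>\<mu>\<in>M. \<Sum>w\<in>V. \<Sum>\<nu>\<in>M. (u \<mu> v * u \<nu> v) * (u \<mu> w * u \<nu> w))" by (rule sum.swap)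
    also have "\<dots> = (\<Sum>\<mu>\<in>M. \<Sum>\<nu>\<in>M. \<Sum>w\<in>V. (u \<mu> v * u \<nu> v) * (u \<mu> w * u \<nu> w))"
      by (intro sum.cong refl sum.swap)
    also have "\<dots> = (\<Sum>\<mu>\<in>M. \<Sum>\<nu>\<in>M. (u \<mu> v * u \<nu> v) * (if \<mu> = \<nu> then 1 else 0))"
      by (intro sum.cong refl) (simp only: sum_distrib_left[symmetric] orth)
    also have "\<dots> = s v" using M(2) by (simp add: sv power2_eq_square if_distrib[of "\<lambda>t. _ * t"] cong: if_cong)
    finally have 3: "(\<Sum>w\<in>V. (s w)\<^sup>2) = s v" .
    have "0 \<le> (\<Sum>w\<in>V. (\<delta> w - s w)\<^sup>2)" by (simp add: sum_nonneg)
    also have "\<dots> = (\<Sum>w\<in>V. (\<delta> w)\<^sup>2) - 2 * (\<Sum>w\<in>V. \<delta> w * s w) + (\<Sum>w\<in>V. (s w)\<^sup>2)"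
      by (simp add: power2_diff sum.distrib sum_subtractf sum_distrib_left mult.assoc)
    finally show ?thesis using 1 2 3 sv by simp
  qed
  have "real (card M) = (\<Sum>\<mu>\<in>M. \<Sum>v\<in>V. (u \<mu> v)\<^sup>2)" using u(1) by simp
  also have "\<dots> = (\<Sum>v\<in>V. \<Sum>\<mu>\<in>M. (u \<mu> v)\<^sup>2)" by (rule sum.swap)
  also have "\<dots> \<le> (\<Sum>v\<in>V. 1)" by (intro sum_mono bessel)
  finally show "card M \<le> card V" by simp
qed

text \<open>The maximal Rayleigh quotient is an eigenvalue, and passing to the moduli of the
  coordinates shows that no eigenvalue has larger modulus.\<close>

lemma spectral_radius_Rayleigh:
  assumes fin: "finite V" "V \<noteq> {}"
  shows "adj_form V E y y \<le> spectral_radius V E * (\<Sum>v\<in>V. (y v)\<^sup>2)" (is ?R)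
    and "\<exists>x. (\<forall>v. 0 \<le> x v) \<and> (\<exists>v\<in>V. x v \<noteq> 0) \<and>
      (\<forall>v\<in>V. (\<Sum>w\<in>nbrs V E v. x w) = spectral_radius V E * x v)" (is ?E)
proof -
  obtain x l where x: "\<forall>v. 0 \<le> x v" "(\<Sum>v\<in>V. (x v)\<^sup>2) = 1" "adj_form V E x x = l"
    "\<forall>y. adj_form V E y y \<le> l * (\<Sum>v\<in>V. (y v)\<^sup>2)"
    using adj_form_maximizer[OF fin, of E] by blast
  have ne: "\<exists>v\<in>V. x v \<noteq> 0"
  proof (rule ccontr)
    assume "\<not> ?thesis" then have "(\<Sum>v\<in>V. (x v)\<^sup>2) = 0" by simp
    then show False using x(2) by simp
  qed
  have eig: "(\<Sum>w\<in>nbrs V E v. x w) = l * x v" if "v \<in> V" for v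
    using adj_form_extremal_eigenvector[OF fin(1), of E l x v] x that by simp
  have l0: "l \<ge> 0" using x(1,3) unfolding adj_form_def by (auto intro!: sum_nonneg)
  have bound: "cmod \<mu> \<le> l" if ev: "adj_eigenvalue V E \<mu>" for \<mu>
  proof -
    obtain z :: "'a \<Rightarrow> complex" where "\<exists>v\<in>V. z v \<noteq> 0" "\<forall>v\<in>V. (\<Sum>w\<in>nbrs V E v. z w) = \<mu> * z v"
      using ev unfolding adj_eigenvalue_def by (elim exE conjE)
    then have z: "\<exists>v\<in>V. z v \<noteq> 0" "\<And>v. v \<in> V \<Longrightarrow> (\<Sum>w\<in>nbrs V E v. z w) = \<mu> * z v" by simp_all
    let ?y = "\<lambda>v. cmod (z v)"
    have "cmod \<mu> * (\<Sum>v\<in>V. (?y v)\<^sup>2) = (\<Sum>v\<in>V. ?y v * cmod (\<mu> * z v))"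
      by (simp add: sum_distrib_left norm_mult power2_eq_square algebra_simps)
    also have "\<dots> \<le> (\<Sum>v\<in>V. ?y v * (\<Sum>w\<in>nbrs V E v. ?y w))"
      by (intro sum_mono mult_left_mono) (simp_all add: z(2)[symmetric] norm_sum)
    also have "\<dots> = adj_form V E ?y ?y" by (simp add: adj_form_eq)
    also have "\<dots> \<le> l * (\<Sum>v\<in>V. (?y v)\<^sup>2)" using x(4) by blast
    finally have le: "cmod \<mu> * (\<Sum>v\<in>V. (?y v)\<^sup>2) \<le> l * (\<Sum>v\<in>V. (?y v)\<^sup>2)" .
    have "(\<Sum>v\<in>V. (?y v)\<^sup>2) \<noteq> 0" using z(1) fin by (simp add: sum_nonneg_eq_0_iff)
    then have "(\<Sum>v\<in>V. (?y v)\<^sup>2) > 0" by (simp add: less_le sum_nonneg)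
    then show ?thesis using le by simp
  qed
  have "adj_eigenvalue V E (complex_of_real l)"
    unfolding adj_eigenvalue_def
  proof (intro exI conjI ballI)
    show "\<exists>v\<in>V. complex_of_real (x v) \<noteq> 0" using ne by simp
    show "(\<Sum>w\<in>nbrs V E v. complex_of_real (x w)) = complex_of_real l * complex_of_real (x v)" if "v \<in> V" for v
      using eig[OF that] unfolding of_real_sum[symmetric] of_real_mult[symmetric] by simp
  qed
  then have "l \<in> {cmod \<mu> | \<mu>. adj_eigenvalue V E \<mu>}" using l0 by force
  \<comment> \<open>Finiteness is what makes the \<open>Max\<close> in
    \<open>spectral_radius\<close> meaningful.\<close>
  moreover have "finite {cmod \<mu> | \<mu>. adj_eigenvalue V E \<mu>}"
    using finite_imageI[OF finite_adj_eigenvalues[OF fin(1), of E], of cmod] by (simp add: image_Collect)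
  ultimately have "spectral_radius V E = l"
    unfolding spectral_radius_def by (intro Max_eqI) (use bound in auto)
  then show ?R ?E using x eig ne by blast+
qed

section \<open>Isomorphism invariance and the hub graph\<close>

lemma graph_iso_sym:
  assumes "graph_iso V E V' E'" shows "graph_iso V' E' V E"
proof -
  obtain f where f: "bij_betw f V V'" "\<And>u v. u \<in> V \<Longrightarrow> v \<in> V \<Longrightarrow> {u, v} \<in> E \<longleftrightarrow> {f u, f v} \<in> E'"
    using assms unfolding graph_iso_def by blast
  let ?g = "inv_into V f"
  have g: "bij_betw ?g V' V" using f(1) by (rule bij_betw_inv_into)
  have "{u, v} \<in> E' \<longleftrightarrow> {?g u, ?g v} \<in> E" if "u \<in> V'" "v \<in> V'" for u v
    using f(2)[of "?g u" "?g v"] bij_betw_inv_into_right[OF f(1)] bij_betwE[OF g] that by simp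
  then show ?thesis unfolding graph_iso_def using g by blast
qed

lemma graph_iso_adj_eigenvalue:
  assumes "graph_iso V E V' E'" "adj_eigenvalue V' E' \<mu>"
  shows "adj_eigenvalue V E \<mu>"
proof -
  obtain f where f: "bij_betw f V V'" "\<And>u v. u \<in> V \<Longrightarrow> v \<in> V \<Longrightarrow> {u, v} \<in> E \<longleftrightarrow> {f u, f v} \<in> E'"
    using assms unfolding graph_iso_def by blast
  obtain x :: "_ \<Rightarrow> complex" where x: "\<exists>v\<in>V'. x v \<noteq> 0" "\<And>v. v \<in> V' \<Longrightarrow> (\<Sum>w\<in>nbrs V' E' v. x w) = \<mu> * x v"
    using assms(2) unfolding adj_eigenvalue_def by blast
  have V': "V' = f ` V" and inj: "inj_on f V" using f(1) by (auto simp: bij_betw_def)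
  show ?thesis
    unfolding adj_eigenvalue_def
  proof (intro exI[of _ "\<lambda>v. x (f v)"] conjI ballI)
    show "\<exists>v\<in>V. x (f v) \<noteq> 0" using x(1) V' by auto
    fix v assume v: "v \<in> V"
    have "nbrs V' E' (f v) = f ` nbrs V E v" using f(2) v V' by auto
    moreover have "inj_on f (nbrs V E v)" using inj by (rule inj_on_subset) auto
    ultimately have "(\<Sum>w\<in>nbrs V E v. x (f w)) = (\<Sum>w\<in>nbrs V' E' (f v). x w)" by (simp add: sum.reindex)
    also have "\<dots> = \<mu> * x (f v)" using x(2) v V' by simp
    finally show "(\<Sum>w\<in>nbrs V E v. x (f w)) = \<mu> * x (f v)" .
  qed
qed

lemma graph_iso_spectral_radius:
  assumes "graph_iso V E V' E'" shows "spectral_radius V E = spectral_radius V' E'"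
proof -
  have "adj_eigenvalue V E \<mu> \<longleftrightarrow> adj_eigenvalue V' E' \<mu>" for \<mu>
    using graph_iso_adj_eigenvalue[OF assms] graph_iso_adj_eigenvalue[OF graph_iso_sym[OF assms]] by blast
  then show ?thesis unfolding spectral_radius_def by simp
qed

text \<open>A copy of \<open>K2_join_edges\<close> on the given vertex set, with freely chosen hubs,
  so that one vector can be tested against both edge sets.\<close>

definition hub_edges :: "'a set \<Rightarrow> 'a \<Rightarrow> 'a \<Rightarrow> 'a set set" where
  "hub_edges V a b = {{a, b}} \<union> {{a, v} | v. v \<in> V - {a, b}} \<union> {{b, v} | v. v \<in> V - {a, b}}"

lemma hub_edges_iff:
  assumes "a \<noteq> b" "a \<in> V" "b \<in> V" "u \<in> V" "v \<in> V"
  shows "{u, v} \<in> hub_edges V a b \<longleftrightarrow> u \<noteq> v \<and> (u \<in> {a, b} \<or> v \<in> {a, b})"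
  using assms unfolding hub_edges_def by (auto simp: doubleton_eq_iff)

lemma K2_join_eq_hub_edges: "K2_join_edges n = hub_edges {0..<n} 0 1"
proof -
  have "i \<in> {0..<n} - {0, 1} \<longleftrightarrow> 2 \<le> i \<and> i < n" for i :: nat by auto
  then show ?thesis unfolding K2_join_edges_def hub_edges_def by simp
qed

lemma hub_edges_iso_K2_join:
  assumes fin: "finite V" and n: "card V = n" and ab: "a \<in> V" "b \<in> V" "a \<noteq> b"
  shows "graph_iso V (hub_edges V a b) (K2_join_verts n) (K2_join_edges n)"
proof -
  have c: "card {a, b} = 2" using ab by simp
  have n2: "n \<ge> 2" using card_mono[OF fin, of "{a,b}"] ab n c by simp
  have "card (V - {a, b}) = n - 2" using card_Diff_subset[of "{a,b}" V] ab n c by simp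
  then have "card (V - {a, b}) = card {2..<n}" by simp
  then obtain g where g: "bij_betw g (V - {a, b}) {2..<n}"
    using fin by (metis finite_Diff finite_atLeastLessThan finite_same_card_bij)
  define f where "f v = (if v = a then 0 else if v = b then 1 else g v)" for v
  have gf: "bij_betw f (V - {a, b}) {2..<n}" using g by (rule bij_betw_cong[THEN iffD1, rotated]) (auto simp: f_def)
  have "bij_betw f {a, b} {0, 1}" using ab by (auto simp: bij_betw_def f_def inj_on_def)
  then have "bij_betw f ({a, b} \<union> (V - {a, b})) ({0, 1} \<union> {2..<n})"
    using gf by (rule bij_betw_combine) auto
  moreover have "{a, b} \<union> (V - {a, b}) = V" "{0, 1} \<union> {2..<n} = {0..<n}" using ab n2 by auto
  ultimately have f: "bij_betw f V {0..<n}" by simp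
  have f01: "f a = 0" "f b = 1" using ab by (auto simp: f_def)
  have fi: "f u = f v \<longleftrightarrow> u = v" if "u \<in> V" "v \<in> V" for u v
    using f that by (auto simp: bij_betw_def inj_on_def)
  have "{u, v} \<in> hub_edges V a b \<longleftrightarrow> {f u, f v} \<in> hub_edges {0..<n} 0 1" if uv: "u \<in> V" "v \<in> V" for u v
  proof -
    have "f u \<in> {0..<n}" "f v \<in> {0..<n}" using bij_betwE[OF f] uv by blast+
    moreover have "(0::nat) \<in> {0..<n}" "(1::nat) \<in> {0..<n}" using n2 by auto
    ultimately have "{f u, f v} \<in> hub_edges {0..<n} 0 1 \<longleftrightarrow> f u \<noteq> f v \<and> (f u \<in> {0, 1} \<or> f v \<in> {0, 1})"
      by (intro hub_edges_iff) auto
    also have "\<dots> \<longleftrightarrow> u \<noteq> v \<and> (u \<in> {a, b} \<or> v \<in> {a, b})"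
      using fi[OF uv] fi[OF uv(1) ab(1)] fi[OF uv(1) ab(2)] fi[OF uv(2) ab(1)] fi[OF uv(2) ab(2)] f01 by auto
    finally show ?thesis using hub_edges_iff[OF ab(3,1,2) uv] by simp
  qed
  then show ?thesis unfolding graph_iso_def K2_join_verts_def K2_join_eq_hub_edges using f by blast
qed

text \<open>The positive root \<open>l\<close> of \<open>l\<^sup>2 = l + 2 * (n - 2)\<close> belongs
  to the eigenvector with \<open>l\<close> on the hubs and 2 elsewhere. The bound by
  \<open>2 * n\<close> needs \<open>l \<ge> 4\<close>, which holds from \<open>n = 8\<close>
  on.\<close>

lemma spectral_radius_hub_edges:
  assumes fin: "finite V" and n: "card V = n" "n \<ge> 8" and ab: "a \<in> V" "b \<in> V" "a \<noteq> b"
  shows "spectral_radius V (hub_edges V a b) \<ge> 0" "2 * real n \<le> (spectral_radius V (hub_edges V a b))\<^sup>2"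
proof -
  let ?E = "hub_edges V a b"
  define l where "l = (1 + sqrt (8 * real n - 15)) / 2"
  have l2: "l\<^sup>2 = l + 2 * (real n - 2)"
  proof -
    have "(sqrt (8 * real n - 15))\<^sup>2 = 8 * real n - 15" using n by simp
    then show ?thesis unfolding l_def by (simp add: power2_eq_square field_simps)
  qed
  have l4: "l \<ge> 4"
  proof -
    have "7 \<le> sqrt (8 * real n - 15)" using n by (intro real_le_rsqrt) auto
    then show ?thesis by (simp add: l_def)
  qed
  define y where "y v = (if v \<in> {a, b} then l else 2)" for v
  have V0: "V \<noteq> {}" using ab by auto
  have W: "card (V - {a, b}) = n - 2" using card_Diff_subset[of "{a,b}" V] ab n by simp
  have hub: "(\<Sum>w\<in>nbrs V ?E c. y w) = l * y c" if c: "c \<in> {a, b}" for c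
  proof -
    obtain d where d: "{a, b} = {c, d}" "c \<noteq> d" using c ab by blast
    have cd: "c \<in> V" "d \<in> V" using ab d by auto
    have "nbrs V ?E c = insert d (V - {a, b})"
      using hub_edges_iff[OF ab(3,1,2)] cd d by auto
    then have "(\<Sum>w\<in>nbrs V ?E c. y w) = y d + (\<Sum>w\<in>V - {a, b}. y w)" using fin d by simp
    also have "(\<Sum>w\<in>V - {a, b}. y w) = (\<Sum>w\<in>V - {a, b}. 2)" by (rule sum.cong) (auto simp: y_def)
    also have "y d + \<dots> = l + 2 * (real n - 2)" using W n d by (auto simp: y_def of_nat_diff)
    finally show ?thesis using l2 c by (simp add: y_def power2_eq_square)
  qed
  have leaf: "(\<Sum>w\<in>nbrs V ?E v. y w) = l * y v" if v: "v \<in> V" "v \<notin> {a, b}" for v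
  proof -
    have "nbrs V ?E v = {a, b}" using hub_edges_iff[OF ab(3,1,2) v(1)] v ab by auto
    then show ?thesis using v ab by (simp add: y_def)
  qed
  have eig: "(\<Sum>w\<in>nbrs V ?E v. y w) = l * y v" if "v \<in> V" for v using hub leaf that by blast
  have "adj_form V ?E y y = l * (\<Sum>v\<in>V. (y v)\<^sup>2)"
    unfolding adj_form_eq using eig by (simp add: sum_distrib_left power2_eq_square algebra_simps)
  with spectral_radius_Rayleigh(1)[OF fin V0, of ?E y] have le: "l * (\<Sum>v\<in>V. (y v)\<^sup>2) \<le> spectral_radius V ?E * (\<Sum>v\<in>V. (y v)\<^sup>2)" by simp
  have "(\<Sum>v\<in>V. (y v)\<^sup>2) > 0" by (rule sum_pos[OF fin V0]) (use l4 in \<open>auto simp: y_def\<close>)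
  then have ll: "l \<le> spectral_radius V ?E" using le by simp
  then show "spectral_radius V ?E \<ge> 0" using l4 by simp
  have "2 * real n \<le> l\<^sup>2" using l2 l4 by simp
  also have "\<dots> \<le> (spectral_radius V ?E)\<^sup>2" using ll l4 by (intro power_mono) auto
  finally show "2 * real n \<le> (spectral_radius V ?E)\<^sup>2" .
qed

section \<open>Graphs of maximal spectral radius\<close>

lemma adj_form_Un:
  assumes "finite A" "finite B" "A \<inter> B = {}"
  shows "adj_form (A \<union> B) E x x = adj_form A E x x + adj_form B E x x + 2 * (\<Sum>v\<in>A. x v * (\<Sum>w\<in>nbrs B E v. x w))"
proof -
  have sp: "(\<Sum>w\<in>nbrs (A \<union> B) E v. x w) = (\<Sum>w\<in>nbrs A E v. x w) + (\<Sum>w\<in>nbrs B E v. x w)" for v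
  proof -
    have "nbrs (A \<union> B) E v = nbrs A E v \<union> nbrs B E v" by auto
    then show ?thesis using assms by (simp add: sum.union_disjoint disjoint_iff)
  qed
  have "(\<Sum>v\<in>B. x v * (\<Sum>w\<in>nbrs A E v. x w)) = (\<Sum>v\<in>B. \<Sum>w\<in>A. if {v, w} \<in> E then x v * x w else 0)"
    using assms by (simp only: sum_distrib_left) (simp add: sum.inter_filter)
  also have "\<dots> = (\<Sum>w\<in>A. \<Sum>v\<in>B. if {v, w} \<in> E then x v * x w else 0)" by (rule sum.swap)
  also have "\<dots> = (\<Sum>w\<in>A. \<Sum>v\<in>B. if {w, v} \<in> E then x w * x v else 0)"
    by (intro sum.cong refl) (simp add: insert_commute mult.commute)
  also have "\<dots> = (\<Sum>v\<in>A. x v * (\<Sum>w\<in>nbrs B E v. x w))"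
    using assms by (simp only: sum_distrib_left) (simp add: sum.inter_filter)
  finally show ?thesis
    by (simp only: adj_form_eq sp sum.union_disjoint[OF assms] distrib_left sum.distrib)
qed

text \<open>Peel off vertices of small degree: each edge is charged to the endpoint removed first,
  with weight at most \<open>M\<close> for the other end. The bound thus scales with the mass of
  \<open>U\<close>.\<close>

lemma adj_form_degenerate_le:
  assumes "finite U" and deg: "\<And>X. X \<subseteq> U \<Longrightarrow> X \<noteq> {} \<Longrightarrow> \<exists>v\<in>X. card (nbrs X E v) \<le> k"
    and loop: "\<And>v. {v} \<notin> E" and x: "\<And>v. 0 \<le> x v" and M: "\<And>v. v \<in> U \<Longrightarrow> x v \<le> M" "0 \<le> M"
  shows "adj_form U E x x \<le> 2 * k * M * (\<Sum>v\<in>U. x v)"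
  using assms(1) deg M(1)
proof (induction U rule: finite_psubset_induct)
  case (psubset U)
  show ?case
  proof (cases "U = {}")
    case True
    then show ?thesis by (simp add: adj_form_def)
  next
    case False
    then obtain v where v: "v \<in> U" "card (nbrs U E v) \<le> k" using psubset.prems(1)[of U] by auto
    let ?U = "U - {v}"
    have "?U \<subset> U" using v by auto
    then have IH: "adj_form ?U E x x \<le> 2 * k * M * (\<Sum>v\<in>?U. x v)"
      using psubset.IH[of ?U] psubset.prems by auto
    have "nbrs {v} E v = {}" using loop by auto
    then have "(\<Sum>w\<in>nbrs {v} E v. x w) = 0" by (simp only: sum.empty)
    then have z: "adj_form {v} E x x = 0" by (simp add: adj_form_eq)
    have "(\<Sum>w\<in>nbrs ?U E v. x w) \<le> (\<Sum>w\<in>nbrs ?U E v. M)"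
      by (rule sum_mono) (use psubset.prems in auto)
    also have "\<dots> = card (nbrs ?U E v) * M" by simp
    also have "\<dots> \<le> k * M"
    proof (rule mult_right_mono)
      have "card (nbrs ?U E v) \<le> card (nbrs U E v)" using psubset.hyps by (intro card_mono) auto
      then show "real (card (nbrs ?U E v)) \<le> real k" using v by simp
    qed (rule M(2))
    finally have s: "x v * (\<Sum>w\<in>nbrs ?U E v. x w) \<le> x v * (k * M)" using x by (intro mult_left_mono) auto
    have "adj_form ({v} \<union> ?U) E x x = adj_form {v} E x x + adj_form ?U E x x + 2 * (\<Sum>v\<in>{v}. x v * (\<Sum>w\<in>nbrs ?U E v. x w))"
      using psubset.hyps by (intro adj_form_Un) auto
    moreover have "{v} \<union> ?U = U" using v by auto
    moreover have "(\<Sum>v\<in>U. x v) = x v + (\<Sum>v\<in>?U. x v)" using psubset.hyps v by (simp add: sum.remove)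
    ultimately show ?thesis using IH s z by (simp add: algebra_simps)
  qed
qed

section \<open>Localisation of the eigenvector\<close>

text \<open>Planarity survives here as \<open>sparse\<close> and \<open>K33\<close>. The vector is
  scaled to maximum 1, and \<open>extremal\<close> ranges over all pairs because the hubs emerge
  only from the analysis.\<close>

locale near_extremal =
  fixes V :: "'a set" and E :: "'a set set" and x :: "'a \<Rightarrow> real" and \<rho> :: real
  assumes fin: "finite V" and big: "216 * 10 ^ 15 \<le> card V"
    and sparse: "\<And>U. U \<subseteq> V \<Longrightarrow> U \<noteq> {} \<Longrightarrow> degree_sum (adj E) U < 12 * card U"
    and K33: "\<And>a b c. a \<in> V \<Longrightarrow> b \<in> V \<Longrightarrow> c \<in> V \<Longrightarrow> a \<noteq> b \<Longrightarrow> a \<noteq> c \<Longrightarrow> b \<noteq> c \<Longrightarrow>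
      card (nbrs V E a \<inter> nbrs V E b \<inter> nbrs V E c) \<le> 2"
    and loop: "\<And>v. {v} \<notin> E"
    and bowtie: "\<And>c u v w z. distinct [c, u, v, w, z] \<Longrightarrow> set [c, u, v, w, z] \<subseteq> V \<Longrightarrow>
      {{c, u}, {u, v}, {c, v}, {c, w}, {w, z}, {c, z}} \<subseteq> E \<Longrightarrow> False"
    and x_nonneg: "\<And>v. 0 \<le> x v" and x_le_1: "\<And>v. v \<in> V \<Longrightarrow> x v \<le> 1" and x_max: "\<exists>v\<in>V. x v = 1"
    and eig: "\<And>v. v \<in> V \<Longrightarrow> (\<Sum>w\<in>nbrs V E v. x w) = \<rho> * x v"
    and \<rho>_nonneg: "0 \<le> \<rho>" and \<rho>_ge: "2 * real (card V) \<le> \<rho>\<^sup>2"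
    and extremal: "\<And>a b. a \<in> V \<Longrightarrow> b \<in> V \<Longrightarrow> a \<noteq> b \<Longrightarrow> spectral_radius V (hub_edges V a b) \<le> \<rho>"
begin

abbreviation "N \<equiv> nbrs V E"
abbreviation "d v \<equiv> real (card (N v))"
abbreviation "n \<equiv> real (card V)"

lemma n_ge: "216000000000000000 \<le> n"
proof -
  have "real (216 * 10 ^ 15) \<le> n" using big by (subst of_nat_le_iff)
  then show ?thesis by simp
qed

text \<open>The square root of \<open>2 * 216 * 10 ^ 15\<close> is about 657 million.\<close>

lemma \<rho>_big: "650000000 \<le> \<rho>"
proof (rule power2_le_imp_le[OF _ \<rho>_nonneg])
  show "650000000\<^sup>2 \<le> \<rho>\<^sup>2" using \<rho>_ge n_ge by simp
qed

lemma finN: "finite (N v)" using fin by simp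

lemma d_le_n: "d v \<le> n" using fin by (simp add: card_mono)

text \<open>Every ordered pair counted on the left also occurs in the degree sum of
  \<open>A \<union> B\<close>; the two sets may overlap.\<close>

lemma edge_count:
  assumes "A \<subseteq> V" "B \<subseteq> V"
  shows "(\<Sum>v\<in>A. real (card (N v \<inter> B))) \<le> 12 * real (card (A \<union> B))"
proof (cases "A \<union> B = {}")
  case False
  have fA: "finite (A \<union> B)" using assms fin finite_subset by blast
  have "(\<Sum>v\<in>A. card (N v \<inter> B)) \<le> (\<Sum>v\<in>A. card {w\<in>A \<union> B. {v, w} \<in> E})"
    by (intro sum_mono card_mono) (use fA in auto)
  also have "\<dots> \<le> degree_sum (adj E) (A \<union> B)"
    unfolding degree_sum_def using fA by (intro sum_mono2) auto
  also have "\<dots> \<le> 12 * card (A \<union> B)" using sparse[of "A \<union> B"] assms False by simp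
  finally have "real (\<Sum>v\<in>A. card (N v \<inter> B)) \<le> real (12 * card (A \<union> B))" by (subst of_nat_le_iff)
  then show ?thesis by simp
qed simp

lemma sum_d_le: "A \<subseteq> V \<Longrightarrow> (\<Sum>v\<in>A. d v) \<le> 12 * n"
proof -
  assume A: "A \<subseteq> V"
  have "N v \<inter> V = N v" for v by auto
  then show ?thesis using edge_count[OF A subset_refl] A by (simp add: Un_absorb1)
qed

lemma two_step: "u \<in> V \<Longrightarrow> \<rho>\<^sup>2 * x u = (\<Sum>v\<in>N u. \<Sum>w\<in>N v. x w)"
proof -
  assume u: "u \<in> V"
  have "\<rho>\<^sup>2 * x u = \<rho> * (\<Sum>v\<in>N u. x v)" using eig[OF u] by (simp add: power2_eq_square)
  also have "\<dots> = (\<Sum>v\<in>N u. \<rho> * x v)" by (simp add: sum_distrib_left)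
  also have "\<dots> = (\<Sum>v\<in>N u. \<Sum>w\<in>N v. x w)" by (intro sum.cong refl) (simp add: eig)
  finally show ?thesis .
qed

lemma \<rho>x_le_d: "v \<in> V \<Longrightarrow> \<rho> * x v \<le> d v"
proof -
  assume v: "v \<in> V"
  have "(\<Sum>w\<in>N v. x w) \<le> (\<Sum>w\<in>N v. 1)" by (rule sum_mono) (use x_le_1 in auto)
  then show ?thesis using eig[OF v] by simp
qed

definition heavy :: "real \<Rightarrow> 'a set" where "heavy \<epsilon> = {v\<in>V. \<epsilon> \<le> x v}"

lemma heavy_V: "heavy \<epsilon> \<subseteq> V" by (auto simp: heavy_def)

lemma fin_heavy: "finite (heavy \<epsilon>)" using fin heavy_V finite_subset by blast

lemma card_heavy_le:
  assumes "c \<ge> 0" "\<And>v. v \<in> heavy \<epsilon> \<Longrightarrow> c \<le> d v"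
  shows "c * card (heavy \<epsilon>) \<le> 12 * n"
proof -
  have "c * card (heavy \<epsilon>) = (\<Sum>v\<in>heavy \<epsilon>. c)" by simp
  also have "\<dots> \<le> (\<Sum>v\<in>heavy \<epsilon>. d v)" by (rule sum_mono) (rule assms)
  also have "\<dots> \<le> 12 * n" by (rule sum_d_le[OF heavy_V])
  finally show ?thesis .
qed

lemma sum_N_le:
  assumes "\<epsilon> \<ge> 0"
  shows "(\<Sum>w\<in>N v. x w) \<le> (\<Sum>w\<in>N v \<inter> heavy \<epsilon>. x w) + \<epsilon> * d v"
proof -
  have "(\<Sum>w\<in>N v. x w) = (\<Sum>w\<in>N v \<inter> heavy \<epsilon>. x w) + (\<Sum>w\<in>N v - heavy \<epsilon>. x w)"
    using finN by (simp add: sum.Int_Diff)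
  also have "(\<Sum>w\<in>N v - heavy \<epsilon>. x w) \<le> (\<Sum>w\<in>N v - heavy \<epsilon>. \<epsilon>)"
    by (rule sum_mono) (auto simp: heavy_def)
  also have "\<dots> \<le> \<epsilon> * d v"
  proof -
    have "card (N v - heavy \<epsilon>) \<le> card (N v)" using finN by (intro card_mono) auto
    then show ?thesis using assms by (simp add: mult.commute mult_left_mono)
  qed
  finally show ?thesis by simp
qed

lemma sum_x_le_card: "A \<subseteq> V \<Longrightarrow> (\<Sum>w\<in>A. x w) \<le> card A"
proof -
  assume "A \<subseteq> V"
  then have "(\<Sum>w\<in>A. x w) \<le> (\<Sum>w\<in>A. 1)" by (intro sum_mono) (use x_le_1 in auto)
  then show ?thesis by simp
qed

text \<open>The threshold makes light neighbours cost at most \<open>1 / 300 * (12 * n)\<close>,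
  that is 0.04 n, in \<open>two_step_le\<close>.\<close>

definition L :: "'a set" where "L = heavy (1 / 300)"

lemma L_V: "L \<subseteq> V" and fin_L: "finite L"
  unfolding L_def by (rule heavy_V, rule fin_heavy)

text \<open>A bootstrap. Since \<open>\<rho> * x v \<le> d v\<close>, vertices with entry at least
  1/8000 have degree of order \<open>\<rho>\<close> and number at most 0.00015 n. In the two-step
  sum from \<open>u\<close> they cost at most 12 (d u + 0.00015 n) and all others 0.0015 n, against
  a total of at least 2 n / 300; what remains forces a linear \<open>d u\<close>.\<close>

lemma d_heavy: "u \<in> L \<Longrightarrow> 28 / 100000 * n \<le> d u"
proof -
  assume u: "u \<in> L"
  let ?H = "heavy (1 / 8000)"
  have uV: "u \<in> V" and xu: "1 / 300 \<le> x u" using u by (auto simp: L_def heavy_def)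
  have "\<rho> * (1 / 8000) * card ?H \<le> 12 * n"
  proof (rule card_heavy_le)
    fix v assume "v \<in> ?H"
    then have "v \<in> V" "1 / 8000 \<le> x v" by (auto simp: heavy_def)
    moreover from this(2) have "\<rho> * (1 / 8000) \<le> \<rho> * x v" using \<rho>_nonneg by (rule mult_left_mono)
    ultimately show "\<rho> * (1 / 8000) \<le> d v" using \<rho>x_le_d[of v] by linarith
  qed (use \<rho>_nonneg in simp)
  moreover have "650000000 * (1 / 8000) * card ?H \<le> \<rho> * (1 / 8000) * card ?H"
    using \<rho>_big by (intro mult_right_mono) auto
  ultimately have H: "card ?H \<le> 96000 / 650000000 * n" by simp
  have "2 * n * (1 / 300) \<le> \<rho>\<^sup>2 * x u"
    using \<rho>_ge xu by (intro mult_mono) auto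
  also have "\<dots> = (\<Sum>v\<in>N u. \<Sum>w\<in>N v. x w)" by (rule two_step[OF uV])
  also have "\<dots> \<le> (\<Sum>v\<in>N u. real (card (N v \<inter> ?H)) + 1 / 8000 * d v)"
  proof (rule sum_mono)
    fix v
    have "(\<Sum>w\<in>N v \<inter> ?H. x w) \<le> card (N v \<inter> ?H)" by (rule sum_x_le_card) auto
    then show "(\<Sum>w\<in>N v. x w) \<le> real (card (N v \<inter> ?H)) + 1 / 8000 * d v" using sum_N_le[of "1/8000" v] by simp
  qed
  also have "\<dots> = (\<Sum>v\<in>N u. real (card (N v \<inter> ?H))) + 1 / 8000 * (\<Sum>v\<in>N u. d v)"
    by (simp add: sum.distrib sum_distrib_left sum_divide_distrib)
  also have "\<dots> \<le> 12 * real (card (N u \<union> ?H)) + 1 / 8000 * (12 * n)"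
    using edge_count[of "N u" ?H] heavy_V sum_d_le[of "N u"] by (intro add_mono mult_left_mono) auto
  finally have "2 * n * (1 / 300) \<le> 12 * real (card (N u \<union> ?H)) + 1 / 8000 * (12 * n)" .
  moreover have "real (card (N u \<union> ?H)) \<le> d u + card ?H"
    using of_nat_mono[OF card_Un_le[of "N u" ?H], where 'a = real] by simp
  ultimately show ?thesis using H n_ge by simp
qed

lemma card_L: "card L \<le> 42858"
proof -
  have "28 / 100000 * n * card L \<le> 12 * n"
    unfolding L_def by (rule card_heavy_le) (use d_heavy in \<open>auto simp: L_def\<close>)
  then have "(28 / 100000 * card L) * n \<le> 12 * n" by (simp add: algebra_simps)
  then have "28 / 100000 * real (card L) \<le> 12" using n_ge by (simp only: mult_le_cancel_right)
  then have "real (card L) \<le> 42858" by simp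
  then show ?thesis by simp
qed

definition B :: "'a set" where "B = {v\<in>V. 3 \<le> card (N v \<inter> L)}"

text \<open>A vertex of \<open>B\<close> is a common neighbour of some triple in \<open>L\<close>,
  and a triple has at most two; 42858 ^ 3 / 3 is about 2.624 * 10 ^ 13.\<close>

lemma card_B: "real (card B) \<le> 26300000000000"
proof -
  let ?T = "{T. T \<subseteq> L \<and> card T = 3}"
  have "B \<subseteq> (\<Union>T\<in>?T. {v\<in>V. T \<subseteq> N v})"
  proof
    fix v assume v: "v \<in> B"
    then obtain T where "T \<subseteq> N v \<inter> L" "card T = 3" "finite T"
      using obtain_subset_with_card_n[of 3 "N v \<inter> L"] by (auto simp: B_def)
    then show "v \<in> (\<Union>T\<in>?T. {v\<in>V. T \<subseteq> N v})" using v by (auto simp: B_def)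
  qed
  moreover have finT: "finite ?T" using fin_L by simp
  ultimately have "card B \<le> card (\<Union>T\<in>?T. {v\<in>V. T \<subseteq> N v})" using fin by (intro card_mono) auto
  also have "\<dots> \<le> (\<Sum>T\<in>?T. card {v\<in>V. T \<subseteq> N v})" by (rule card_UN_le[OF finT])
  also have "\<dots> \<le> (\<Sum>T\<in>?T. 2)"
  proof (rule sum_mono)
    fix T assume "T \<in> ?T"
    then obtain a b c where T: "T = {a, b, c}" "a \<noteq> b" "a \<noteq> c" "b \<noteq> c" "T \<subseteq> L" by (auto simp: card_3_iff)
    have "{v\<in>V. T \<subseteq> N v} \<subseteq> N a \<inter> N b \<inter> N c" using T(1) by (auto simp: insert_commute)
    then have "card {v\<in>V. T \<subseteq> N v} \<le> card (N a \<inter> N b \<inter> N c)" using finN by (intro card_mono) auto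
    also have "\<dots> \<le> 2" using T L_V by (intro K33) auto
    finally show "card {v\<in>V. T \<subseteq> N v} \<le> 2" .
  qed
  also have "\<dots> = 2 * (card L choose 3)" using n_subsets[OF fin_L, of 3] by simp
  finally have 1: "real (card B) \<le> 2 * real (card L choose 3)" by simp
  have "(card L choose 3) * fact 3 \<le> 42858 ^ 3"
    using binomial_fact_pow[of "card L" 3] power_mono[OF card_L, of 3] by simp
  then have "6 * (card L choose 3) \<le> 42858 ^ 3" by (simp add: fact_numeral)
  then have "real (6 * (card L choose 3)) \<le> real (42858 ^ 3)" by (subst of_nat_le_iff)
  then show ?thesis using 1 by simp
qed

text \<open>A neighbour of \<open>u\<close> outside \<open>B\<close> sees \<open>u\<close> and at
  most one further member of \<open>L\<close>, so these pass on at most \<open>x u + \<tau>\<close>.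
  The error 0.0415 n is 0.04 n for light vertices plus \<open>12 * card (B \<union> L)\<close>,
  which the size of \<open>n\<close> keeps below 0.0015 n.\<close>

lemma two_step_le:
  assumes u: "u \<in> L" and \<tau>: "0 \<le> \<tau>" "\<And>w. w \<in> L \<Longrightarrow> w \<noteq> u \<Longrightarrow> x w \<le> \<tau>"
  shows "\<rho>\<^sup>2 * x u \<le> d u * (x u + \<tau>) + 415 / 10000 * n"
proof -
  have uV: "u \<in> V" using u L_V by auto
  have BV: "B \<subseteq> V" by (auto simp: B_def)
  have inner: "(\<Sum>w\<in>N v \<inter> L. x w) \<le> (x u + \<tau>) + (if v \<in> B then real (card (N v \<inter> L)) else 0)" if v: "v \<in> N u" for v
  proof (cases "v \<in> B")
    case True
    have "(\<Sum>w\<in>N v \<inter> L. x w) \<le> card (N v \<inter> L)" using L_V by (intro sum_x_le_card) auto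
    then show ?thesis using True \<tau>(1) x_nonneg[of u] by simp
  next
    case False
    have uv: "u \<in> N v \<inter> L" using v u uV by (simp add: insert_commute)
    have f: "finite (N v \<inter> L)" using finN by simp
    have "card (N v \<inter> L) \<le> 2" using False v by (auto simp: B_def)
    then have c: "card (N v \<inter> L - {u}) \<le> 1" using uv f by simp
    have "(\<Sum>w\<in>N v \<inter> L - {u}. x w) \<le> (\<Sum>w\<in>N v \<inter> L - {u}. \<tau>)" by (rule sum_mono) (use \<tau>(2) in auto)
    also have "\<dots> = card (N v \<inter> L - {u}) * \<tau>" by simp
    also have "\<dots> \<le> 1 * \<tau>" using c \<tau>(1) by (intro mult_right_mono) auto
    finally show ?thesis using False f uv by (simp add: sum.remove)
  qed
  have "\<rho>\<^sup>2 * x u = (\<Sum>v\<in>N u. \<Sum>w\<in>N v. x w)" by (rule two_step[OF uV])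
  also have "\<dots> \<le> (\<Sum>v\<in>N u. (x u + \<tau>) + (if v \<in> B then real (card (N v \<inter> L)) else 0) + 1 / 300 * d v)"
  proof (rule sum_mono)
    fix v assume "v \<in> N u"
    then show "(\<Sum>w\<in>N v. x w) \<le> (x u + \<tau>) + (if v \<in> B then real (card (N v \<inter> L)) else 0) + 1 / 300 * d v"
      using inner[of v] sum_N_le[of "1 / 300" v] unfolding L_def by linarith
  qed
  also have "\<dots> = d u * (x u + \<tau>) + (\<Sum>v\<in>N u. if v \<in> B then real (card (N v \<inter> L)) else 0) + 1 / 300 * (\<Sum>v\<in>N u. d v)"
    by (simp add: sum.distrib sum_divide_distrib)
  also have "\<dots> \<le> d u * (x u + \<tau>) + 12 * real (card (B \<union> L)) + 1 / 300 * (12 * n)"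
  proof -
    have "(\<Sum>v\<in>N u. if v \<in> B then real (card (N v \<inter> L)) else 0) = (\<Sum>v\<in>N u \<inter> B. real (card (N v \<inter> L)))"
      using finN by (simp add: sum.inter_restrict)
    also have "\<dots> \<le> (\<Sum>v\<in>B. real (card (N v \<inter> L)))"
      using BV fin finite_subset by (intro sum_mono2) auto
    also have "\<dots> \<le> 12 * real (card (B \<union> L))" by (rule edge_count[OF BV L_V])
    finally have 1: "(\<Sum>v\<in>N u. if v \<in> B then real (card (N v \<inter> L)) else 0) \<le> 12 * real (card (B \<union> L))" .
    have "(\<Sum>v\<in>N u. d v) \<le> 12 * n" by (rule sum_d_le) auto
    with 1 show ?thesis by linarith
  qed
  finally have "\<rho>\<^sup>2 * x u \<le> d u * (x u + \<tau>) + 12 * real (card (B \<union> L)) + 1 / 300 * (12 * n)" .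
  moreover have "real (card (B \<union> L)) \<le> real (card B) + card L"
    using of_nat_mono[OF card_Un_le[of B L], where 'a = real] by simp
  moreover have "real (card L) \<le> 42858" using card_L by simp
  ultimately show ?thesis using card_B n_ge by linarith
qed

lemma hubs:
  obtains a b where "a \<in> V" "b \<in> V" "a \<noteq> b" "x a = 1" "95 / 100 \<le> x b"
    "936 / 1000 * n \<le> card (N a \<inter> N b)"
proof -
  obtain a where a: "a \<in> V" "x a = 1" using x_max by blast
  then have aL: "a \<in> L" by (auto simp: L_def heavy_def)
  \<comment> \<open>A single heavy vertex would give 2 n \<le> 1.0415 n.\<close>
  have ne: "L - {a} \<noteq> {}"
  proof
    assume e: "L - {a} = {}"
    have "\<rho>\<^sup>2 * x a \<le> d a * (x a + 0) + 415 / 10000 * n"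
      by (rule two_step_le[OF aL]) (use e in auto)
    then show False using \<rho>_ge a d_le_n[of a] n_ge by simp
  qed
  define t where "t = Max (x ` (L - {a}))"
  have "t \<in> x ` (L - {a})" unfolding t_def using ne fin_L by (intro Max_in) auto
  then obtain b where b: "b \<in> L" "b \<noteq> a" "x b = t" by auto
  have tmax: "x w \<le> t" if "w \<in> L" "w \<noteq> a" for w unfolding t_def using that fin_L by (intro Max_ge) auto
  have bV: "b \<in> V" using b L_V by auto
  have t01: "0 \<le> t" "t \<le> 1" using x_nonneg[of b] x_le_1[OF bV] b by auto
  have n0: "n > 0" using n_ge by simp
  \<comment> \<open>Here \<open>d a \<le> n\<close> forces \<open>t \<ge> 0.9585\<close>, and
    \<open>t \<le> 1\<close> forces \<open>d a\<close> to be at least 0.97925 n.\<close>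
  have A: "2 * n \<le> d a * (1 + t) + 415 / 10000 * n"
    using two_step_le[OF aL t01(1) tmax] \<rho>_ge a by simp
  have "d a * (1 + t) \<le> n * (1 + t)" using d_le_n t01 by (intro mult_right_mono) auto
  then have "(9585 / 10000) * n \<le> t * n" using A by (simp add: algebra_simps)
  then have t: "9585 / 10000 \<le> t" using n0 by (simp only: mult_le_cancel_right)
  have "d a * (1 + t) \<le> d a * 2" using t01 by (intro mult_left_mono) auto
  then have da: "97925 / 100000 * n \<le> d a" using A by simp
  have "\<rho>\<^sup>2 * t \<le> d b * (t + 1) + 415 / 10000 * n"
    using two_step_le[OF b(1), of 1] x_le_1 L_V b(3) by auto
  moreover have "2 * n * t \<le> \<rho>\<^sup>2 * t" using \<rho>_ge t01 by (intro mult_right_mono) auto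
  ultimately have B: "2 * n * t \<le> d b * (t + 1) + 415 / 10000 * n" by linarith
  \<comment> \<open>Seen from \<open>b\<close> the other entries are bounded by 1 only, as
    \<open>a\<close> is among them. At \<open>t = 0.9585\<close> this still leaves
    \<open>d b\<close> just above 0.957 n, so the neighbourhoods overlap in at least 0.936
    n.\<close>
  have db: "957 / 1000 * n \<le> d b"
  proof (rule ccontr)
    assume "\<not> ?thesis"
    then have "d b * (t + 1) \<le> 957 / 1000 * n * (t + 1)" using t01 by (intro mult_right_mono) auto
    then have "(1043 / 1000 * t) * n \<le> 9985 / 10000 * n" using B by (simp add: algebra_simps)
    then have "1043 / 1000 * t \<le> 9985 / 10000" using n0 by (simp only: mult_le_cancel_right)
    then show False using t by simp
  qed
  have "card (N a \<union> N b) \<le> card V" using fin by (intro card_mono) auto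
  moreover have "card (N a) + card (N b) = card (N a \<union> N b) + card (N a \<inter> N b)"
    by (intro card_Un_Int finN)
  ultimately have "card (N a) + card (N b) \<le> card V + card (N a \<inter> N b)" by simp
  from of_nat_mono[OF this, where 'a = real] have "d a + d b \<le> n + card (N a \<inter> N b)" by simp
  then have "936 / 1000 * n \<le> card (N a \<inter> N b)" using da db n0 by simp
  then show ?thesis using that[of a b] a b bV t by auto
qed

lemma degenerate:
  assumes "X \<subseteq> V" "X \<noteq> {}"
  shows "\<exists>v\<in>X. card (nbrs X E v) \<le> 11"
proof (rule ccontr)
  assume "\<not> ?thesis"
  then have "(\<Sum>v\<in>X. 12) \<le> degree_sum (adj E) X"
    unfolding degree_sum_def by (intro sum_mono) force
  then show False using sparse[OF assms] by simp
qed

lemma card_N_common: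
  assumes "a \<in> V" "b \<in> V" "a \<noteq> b" "v \<in> V" "v \<noteq> a" "v \<noteq> b"
  shows "card (nbrs (N a \<inter> N b) E v) \<le> 2"
proof -
  have "nbrs (N a \<inter> N b) E v \<subseteq> N a \<inter> N b \<inter> N v" by auto
  then have "card (nbrs (N a \<inter> N b) E v) \<le> card (N a \<inter> N b \<inter> N v)" using finN by (intro card_mono) auto
  also have "\<dots> \<le> 2" using assms by (intro K33) auto
  finally show ?thesis .
qed

text \<open>Let \<open>M\<close> be the largest non-hub entry, attained at \<open>m\<close>.
  Neighbours of \<open>m\<close> outside \<open>R\<close> number at most 4 and are negligible. A
  vertex of \<open>R\<close> sees at most one hub and two common neighbours, and edges inside
  \<open>R\<close> add \<open>12 * card R\<close>, whence the 14. As \<open>card R\<close> is at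
  most 0.064 n, hence at most 0.032 \<open>\<rho>\<^sup>2\<close>, this gives M (1 - 0.448) \<le>
  0.032 up to a tiny term.\<close>

lemma x_small:
  assumes ab: "a \<in> V" "b \<in> V" "a \<noteq> b" and D: "936 / 1000 * n \<le> card (N a \<inter> N b)"
    and w: "w \<in> V - {a, b}"
  shows "x w \<le> 58 / 1000"
proof -
  let ?D = "N a \<inter> N b" and ?W = "V - {a, b}"
  define R where "R = ?W - ?D"
  have finW: "finite ?W" "?W \<noteq> {}" using fin w by auto
  define M where "M = Max (x ` ?W)"
  have "M \<in> x ` ?W" unfolding M_def using finW by (intro Max_in) auto
  then obtain m where m: "m \<in> ?W" "x m = M" by auto
  have M: "x v \<le> M" if "v \<in> ?W" for v unfolding M_def using that finW by (intro Max_ge) auto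
  have M0: "0 \<le> M" using x_nonneg[of m] m by simp
  have DW: "?D \<subseteq> ?W" using loop by auto
  have RV: "R \<subseteq> V" "finite R" using fin by (auto simp: R_def)
  have "card (R \<union> ?D) = card R + card ?D"
    by (rule card_Un_disjoint) (use finN RV in \<open>auto simp: R_def\<close>)
  moreover have "card (R \<union> ?D) \<le> card V" by (rule card_mono[OF fin]) (use RV in auto)
  ultimately have "card R + card ?D \<le> card V" by simp
  from of_nat_mono[OF this, where 'a = real] have "real (card R) + card ?D \<le> n" by simp
  then have cR: "real (card R) \<le> 64 / 1000 * n" using D by simp
  have inner: "(\<Sum>y\<in>N v. x y) \<le> 1 + M * (2 + real (card (N v \<inter> R)))" if v: "v \<in> R" for v
  proof -
    have vV: "v \<in> V" "v \<noteq> a" "v \<noteq> b" using v by (auto simp: R_def)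
    have "N v = (N v \<inter> {a, b}) \<union> (nbrs ?D E v \<union> (N v \<inter> R))" by (auto simp: R_def)
    moreover have "(N v \<inter> {a, b}) \<inter> (nbrs ?D E v \<union> (N v \<inter> R)) = {}" using DW by (auto simp: R_def)
    moreover have "nbrs ?D E v \<inter> (N v \<inter> R) = {}" by (auto simp: R_def)
    ultimately have "(\<Sum>y\<in>N v. x y) = (\<Sum>y\<in>N v \<inter> {a, b}. x y) + ((\<Sum>y\<in>nbrs ?D E v. x y) + (\<Sum>y\<in>N v \<inter> R. x y))"
      using finN by (metis (no_types, lifting) finite_Int finite_Un sum.union_disjoint)
    moreover have "(\<Sum>y\<in>N v \<inter> {a, b}. x y) \<le> 1"
    proof -
      have "N v \<inter> {a, b} \<subseteq> {a} \<or> N v \<inter> {a, b} \<subseteq> {b}"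
        using v by (auto simp: R_def insert_commute)
      then have "card (N v \<inter> {a, b}) \<le> 1" using card_mono[of "{a}"] card_mono[of "{b}"] by fastforce
      moreover have "(\<Sum>y\<in>N v \<inter> {a, b}. x y) \<le> card (N v \<inter> {a, b})" by (rule sum_x_le_card) auto
      ultimately show ?thesis by simp
    qed
    moreover have "(\<Sum>y\<in>nbrs ?D E v. x y) \<le> 2 * M"
    proof -
      have "(\<Sum>y\<in>nbrs ?D E v. x y) \<le> (\<Sum>y\<in>nbrs ?D E v. M)" by (rule sum_mono) (use M DW in auto)
      also have "\<dots> = card (nbrs ?D E v) * M" by simp
      also have "\<dots> \<le> 2 * M" using card_N_common[OF ab vV] M0 by (intro mult_right_mono) auto
      finally show ?thesis .
    qed
    moreover have "(\<Sum>y\<in>N v \<inter> R. x y) \<le> card (N v \<inter> R) * M"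
    proof -
      have "(\<Sum>y\<in>N v \<inter> R. x y) \<le> (\<Sum>y\<in>N v \<inter> R. M)" by (rule sum_mono) (use M in \<open>auto simp: R_def\<close>)
      then show ?thesis by simp
    qed
    ultimately show ?thesis by (simp add: algebra_simps)
  qed
  have "(\<Sum>v\<in>R. \<rho> * x v) = (\<Sum>v\<in>R. \<Sum>y\<in>N v. x y)" by (intro sum.cong refl) (use RV eig in auto)
  also have "\<dots> \<le> (\<Sum>v\<in>R. 1 + M * (2 + real (card (N v \<inter> R))))" by (rule sum_mono) (rule inner)
  also have "\<dots> = card R + M * (2 * card R + (\<Sum>v\<in>R. real (card (N v \<inter> R))))"
    by (simp add: sum.distrib sum_distrib_left algebra_simps)
  also have "\<dots> \<le> card R + M * (2 * card R + 12 * card R)"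
    using edge_count[OF RV(1) RV(1)] M0 by (intro add_left_mono mult_left_mono) auto
  finally have sR: "(\<Sum>v\<in>R. \<rho> * x v) \<le> card R * (1 + 14 * M)" by (simp add: algebra_simps)
  have "\<rho>\<^sup>2 * M = (\<Sum>v\<in>N m. \<rho> * x v)"
    using eig[of m] m by (simp add: power2_eq_square sum_distrib_left[symmetric])
  also have "\<dots> \<le> 4 * \<rho> + (\<Sum>v\<in>R. \<rho> * x v)"
  proof -
    have mV: "m \<in> V" "m \<noteq> a" "m \<noteq> b" using m by auto
    have fD: "finite (nbrs ?D E m)" by (rule finite_subset[OF _ fin]) auto
    have "N m \<subseteq> ({a, b} \<union> nbrs ?D E m) \<union> R" by (auto simp: R_def)
    then have "(\<Sum>v\<in>N m. \<rho> * x v) \<le> (\<Sum>v\<in>({a, b} \<union> nbrs ?D E m) \<union> R. \<rho> * x v)"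
      using fD RV \<rho>_nonneg x_nonneg by (intro sum_mono2) auto
    also have "\<dots> \<le> (\<Sum>v\<in>{a, b} \<union> nbrs ?D E m. \<rho> * x v) + (\<Sum>v\<in>R. \<rho> * x v)"
    proof -
      have "(\<Sum>v\<in>({a, b} \<union> nbrs ?D E m) \<inter> R. \<rho> * x v) \<ge> 0" using \<rho>_nonneg x_nonneg by (intro sum_nonneg) auto
      then show ?thesis using sum.union_inter[of "{a, b} \<union> nbrs ?D E m" R "\<lambda>v. \<rho> * x v"] fD RV by simp
    qed
    also have "(\<Sum>v\<in>{a, b} \<union> nbrs ?D E m. \<rho> * x v) \<le> (\<Sum>v\<in>{a, b} \<union> nbrs ?D E m. \<rho>)"
    proof (rule sum_mono)
      fix v assume "v \<in> {a, b} \<union> nbrs ?D E m"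
      then have "x v \<le> 1" using ab by (intro x_le_1) auto
      then show "\<rho> * x v \<le> \<rho>" using \<rho>_nonneg by (simp add: mult_left_le)
    qed
    also have "\<dots> = card ({a, b} \<union> nbrs ?D E m) * \<rho>" by simp
    also have "\<dots> \<le> 4 * \<rho>"
    proof (rule mult_right_mono[OF _ \<rho>_nonneg])
      have "card ({a, b} \<union> nbrs ?D E m) \<le> card {a, b} + card (nbrs ?D E m)" by (rule card_Un_le)
      then show "real (card ({a, b} \<union> nbrs ?D E m)) \<le> 4" using card_N_common[OF ab mV] ab by simp
    qed
    finally show ?thesis by simp
  qed
  finally have 1: "\<rho>\<^sup>2 * M \<le> 4 * \<rho> + card R * (1 + 14 * M)" using sR by simp
  have "650000000 * \<rho> \<le> \<rho> * \<rho>" using \<rho>_big \<rho>_nonneg by (intro mult_right_mono) auto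
  then have 2: "4 * \<rho> \<le> \<rho>\<^sup>2 / 100000000" using \<rho>_nonneg by (simp add: power2_eq_square)
  have "card R * (1 + 14 * M) \<le> (64 / 1000 * n) * (1 + 14 * M)" using cR M0 by (intro mult_right_mono) auto
  also have "\<dots> \<le> (32 / 1000 * \<rho>\<^sup>2) * (1 + 14 * M)" using \<rho>_ge M0 by (intro mult_right_mono) auto
  finally have "\<rho>\<^sup>2 * M \<le> \<rho>\<^sup>2 / 100000000 + (32 / 1000 * \<rho>\<^sup>2) * (1 + 14 * M)" using 1 2 by linarith
  then have "M * \<rho>\<^sup>2 \<le> (1 / 100000000 + 32 / 1000 * (1 + 14 * M)) * \<rho>\<^sup>2" by (simp add: algebra_simps)
  then have "M \<le> 1 / 100000000 + 32 / 1000 * (1 + 14 * M)"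
    using \<rho>_big by (simp only: mult_le_cancel_right) simp
  then have "M \<le> 58 / 1000" by (simp add: field_simps)
  then show ?thesis using M[OF w] by simp
qed

section \<open>Comparison with the hub graph\<close>

text \<open>Stated for arbitrary loop-free \<open>F\<close>, since it expands both the given graph
  and the hub graph, whose forms are then compared term by term.\<close>

lemma hub_form:
  assumes F: "\<And>v. {v} \<notin> F" and ab: "a \<in> V" "b \<in> V" "a \<noteq> b"
  shows "adj_form V F x x = adj_form (V - {a, b}) F x x +
    2 * x b * (\<Sum>w\<in>nbrs (V - {a, b}) F b. x w) +
    2 * x a * ((\<Sum>w\<in>nbrs (V - {a, b}) F a. x w) + (if {a, b} \<in> F then x b else 0))"
proof -
  let ?W = "V - {a, b}"
  have one: "adj_form ({c} \<union> U) F x x = adj_form U F x x + 2 * x c * (\<Sum>w\<in>nbrs U F c. x w)"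
    if "finite U" "c \<notin> U" for c U
  proof -
    have "nbrs {c} F c = {}" using F by auto
    then have "(\<Sum>w\<in>nbrs {c} F c. x w) = 0" by (simp only: sum.empty)
    then have "adj_form {c} F x x = 0" by (simp add: adj_form_eq)
    then show ?thesis using adj_form_Un[of "{c}" U F x] that by (simp add: mult.assoc)
  qed
  have V: "V = {a} \<union> ({b} \<union> ?W)" using ab by auto
  have "(\<Sum>w\<in>nbrs ({b} \<union> ?W) F a. x w) = (\<Sum>w\<in>nbrs ?W F a. x w) + (if {a, b} \<in> F then x b else 0)"
  proof (cases "{a, b} \<in> F")
    case True
    then have "nbrs ({b} \<union> ?W) F a = insert b (nbrs ?W F a)" by auto
    then show ?thesis using True fin by simp
  next
    case False
    then have "nbrs ({b} \<union> ?W) F a = nbrs ?W F a" by auto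
    then show ?thesis using False by simp
  qed
  then have "adj_form ({a} \<union> ({b} \<union> ?W)) F x x = adj_form ?W F x x + 2 * x b * (\<Sum>w\<in>nbrs ?W F b. x w) +
    2 * x a * ((\<Sum>w\<in>nbrs ?W F a. x w) + (if {a, b} \<in> F then x b else 0))"
    using one[of "{b} \<union> ?W" a] one[of ?W b] fin ab by simp
  then show ?thesis using V by simp
qed

text \<open>With \<open>r\<close> a third common neighbour, the triangles \<open>a p q\<close> and
  \<open>a b r\<close> would share exactly \<open>a\<close>.\<close>

lemma common_independent:
  assumes ab: "a \<in> V" "b \<in> V" "a \<noteq> b" "{a, b} \<in> E" and D: "3 \<le> card (N a \<inter> N b)"
    and pq: "p \<in> N a \<inter> N b" "q \<in> N a \<inter> N b"
  shows "{p, q} \<notin> E"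
proof
  assume e: "{p, q} \<in> E"
  have "\<not> N a \<inter> N b \<subseteq> {p, q}"
  proof
    assume "N a \<inter> N b \<subseteq> {p, q}"
    then have "card (N a \<inter> N b) \<le> card {p, q}" by (intro card_mono) auto
    also have "\<dots> \<le> 2" by (simp add: card_insert_if)
    finally show False using D by simp
  qed
  then obtain r where r: "r \<in> N a \<inter> N b" "r \<noteq> p" "r \<noteq> q" by blast
  have ne: "p \<noteq> q" "p \<noteq> a" "p \<noteq> b" "q \<noteq> a" "q \<noteq> b" "r \<noteq> a" "r \<noteq> b"
    using e pq r loop by auto
  show False
    by (rule bowtie[of a p q b r]) (use ne pq r ab e in \<open>auto simp: insert_commute\<close>)
qed

text \<open>Two disjoint edges among the common neighbours would form triangles with
  \<open>a\<close> meeting only there, so all edges meet one edge \<open>p q\<close>. Each of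
  \<open>p\<close>, \<open>q\<close> has at most two neighbours inside, which gives
  \<open>4 * M\<^sup>2\<close> within the pair and twice \<open>4 * M\<^sup>2\<close> for the edges
  leaving it.\<close>

lemma common_form_le:
  assumes ab: "a \<in> V" "b \<in> V" "a \<noteq> b" and D: "3 \<le> card (N a \<inter> N b)"
    and M: "0 \<le> M" "\<And>v. v \<in> N a \<inter> N b \<Longrightarrow> x v \<le> M"
  shows "adj_form (N a \<inter> N b) E x x \<le> (if {a, b} \<in> E then 0 else 12 * M\<^sup>2)"
proof -
  let ?D = "N a \<inter> N b"
  have indep: "adj_form U E x x = 0" if "\<And>u v. u \<in> U \<Longrightarrow> v \<in> U \<Longrightarrow> {u, v} \<notin> E" for U
  proof -
    have "nbrs U E v = {}" if "v \<in> U" for v using that \<open>\<And>u v. u \<in> U \<Longrightarrow> v \<in> U \<Longrightarrow> {u, v} \<notin> E\<close> by blast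
    then have "(\<Sum>w\<in>nbrs U E v. x w) = 0" if "v \<in> U" for v using that by (simp only: sum.empty)
    then show ?thesis by (simp add: adj_form_eq)
  qed
  show ?thesis
  proof (cases "\<exists>p\<in>?D. \<exists>q\<in>?D. {p, q} \<in> E")
    case False
    then have "adj_form ?D E x x = 0" by (intro indep) blast
    then show ?thesis by simp
  next
    case True
    then obtain p q where pq: "p \<in> ?D" "q \<in> ?D" "{p, q} \<in> E" by blast
    then have nab: "{a, b} \<notin> E" using common_independent[OF ab _ D pq(1,2)] by blast
    have ne: "p \<noteq> q" "p \<noteq> a" "q \<noteq> a" using pq loop by auto
    let ?D' = "?D - {p, q}"
    have finD: "finite ?D" using finN by simp
    have D': "adj_form ?D' E x x = 0"
    proof (rule indep, rule notI)
      fix u v assume uv: "u \<in> ?D'" "v \<in> ?D'" "{u, v} \<in> E"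
      then have "u \<noteq> v" "u \<noteq> a" "v \<noteq> a" using loop by auto
      then show False
        by (intro bowtie[of a p q u v]) (use ne pq uv ab in auto)
    qed
    have inner: "x v * (\<Sum>w\<in>nbrs U E v. x w) \<le> 2 * M\<^sup>2" if "v \<in> ?D" "U \<subseteq> ?D" for v U
    proof -
      have v: "v \<in> V" "v \<noteq> a" "v \<noteq> b" using that loop by auto
      have "(\<Sum>w\<in>nbrs U E v. x w) \<le> (\<Sum>w\<in>nbrs U E v. M)" by (rule sum_mono) (use M that in auto)
      also have "\<dots> = card (nbrs U E v) * M" by simp
      also have "\<dots> \<le> 2 * M"
      proof (rule mult_right_mono[OF _ M(1)])
        have "card (nbrs U E v) \<le> card (nbrs ?D E v)" by (rule card_mono) (use fin that in auto)
        then show "real (card (nbrs U E v)) \<le> 2" using card_N_common[OF ab v] by simp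
      qed
      finally have "x v * (\<Sum>w\<in>nbrs U E v. x w) \<le> M * (2 * M)"
        using M that x_nonneg by (intro mult_mono) (auto intro!: sum_nonneg)
      then show ?thesis by (simp add: power2_eq_square)
    qed
    have two: "(\<Sum>v\<in>{p, q}. x v * (\<Sum>w\<in>nbrs U E v. x w)) \<le> 4 * M\<^sup>2" if U: "U \<subseteq> ?D" for U
      using inner[OF pq(1) U] inner[OF pq(2) U] ne by simp
    have "adj_form ({p, q} \<union> ?D') E x x = adj_form {p, q} E x x + adj_form ?D' E x x +
        2 * (\<Sum>v\<in>{p, q}. x v * (\<Sum>w\<in>nbrs ?D' E v. x w))"
      using finD by (intro adj_form_Un) auto
    moreover have "{p, q} \<union> ?D' = ?D" using pq by auto
    moreover have "adj_form {p, q} E x x \<le> 4 * M\<^sup>2" unfolding adj_form_eq by (rule two) (use pq in auto)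
    moreover have "(\<Sum>v\<in>{p, q}. x v * (\<Sum>w\<in>nbrs ?D' E v. x w)) \<le> 4 * M\<^sup>2" by (rule two) auto
    ultimately have "adj_form ?D E x x \<le> 12 * M\<^sup>2" using D' by simp
    then show ?thesis using nab by simp
  qed
qed

text \<open>Rewiring every vertex to the two hubs gains at least \<open>2 x\<^sub>b\<close> per unit of eigenvector mass outside
  the common neighbourhood, and loses at most \<open>26 \<cdot> 58 / 1000\<close> of it.\<close>

lemma is_hub_graph:
  "\<exists>a\<in>V. \<exists>b\<in>V. a \<noteq> b \<and> (\<forall>u\<in>V. \<forall>v\<in>V. {u, v} \<in> E \<longleftrightarrow> {u, v} \<in> hub_edges V a b)"
proof -
  obtain a b where ab: "a \<in> V" "b \<in> V" "a \<noteq> b" and xa: "x a = 1" and xb: "95 / 100 \<le> x b"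
    and D: "936 / 1000 * n \<le> card (N a \<inter> N b)"
    by (rule hubs)
  let ?D = "N a \<inter> N b" and ?W = "V - {a, b}" and ?T = "hub_edges V a b"
  define R where "R = ?W - ?D"
  define M :: real where "M = 58 / 1000"
  have V0: "V \<noteq> {}" using ab by auto
  have D3: "3 \<le> card ?D" using D n_ge by linarith
  have DW: "?D \<subseteq> ?W" using loop by auto
  have W: "?W = R \<union> ?D" "R \<inter> ?D = {}" using DW by (auto simp: R_def)
  have RV: "R \<subseteq> V" "finite R" using fin by (auto simp: R_def)
  have finD: "finite ?D" using finN by simp
  have small: "x w \<le> M" if "w \<in> ?W" for w unfolding M_def by (rule x_small[OF ab D that])
  have xb1: "x b \<le> 1" using x_le_1 ab by simp
  note hub = hub_edges_iff[OF ab(3,1,2)]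
  define S where "S = (\<Sum>v\<in>R. x v)"
  have S0: "0 \<le> S" unfolding S_def using x_nonneg by (simp add: sum_nonneg)
  have loopT: "{v} \<notin> ?T" for v using ab by (auto simp: hub_edges_def)
  have fT: "adj_form V ?T x x = 2 * x b * (\<Sum>w\<in>?W. x w) + 2 * ((\<Sum>w\<in>?W. x w) + x b)"
  proof -
    have "nbrs ?W ?T v = {}" if "v \<in> ?W" for v using that hub by auto
    then have "(\<Sum>w\<in>nbrs ?W ?T v. x w) = 0" if "v \<in> ?W" for v using that by (simp only: sum.empty)
    then have "adj_form ?W ?T x x = 0" unfolding adj_form_eq by (intro sum.neutral) simp
    moreover have "nbrs ?W ?T a = ?W" "nbrs ?W ?T b = ?W" using hub ab by auto
    moreover have "{a, b} \<in> ?T" by (simp add: hub_edges_def)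
    ultimately show ?thesis using hub_form[of ?T, OF loopT ab] xa by (simp only: if_True)
  qed
  have split: "(\<Sum>w\<in>?W. x w) = (\<Sum>w\<in>nbrs ?W E c. x w) + (\<Sum>w\<in>?W - N c. x w)" for c
  proof -
    have "?W \<inter> N c = nbrs ?W E c" by auto
    then show ?thesis using sum.Int_Diff[of ?W x "N c"] fin by simp
  qed
  \<comment> \<open>A vertex of \<open>R\<close> misses at least one hub, so it is counted in one of
    the two sums.\<close>
  have Rsum: "S \<le> (\<Sum>w\<in>?W - N a. x w) + (\<Sum>w\<in>?W - N b. x w)"
  proof -
    have "S \<le> (\<Sum>w\<in>(?W - N a) \<union> (?W - N b). x w)"
      unfolding S_def using fin x_nonneg by (intro sum_mono2) (auto simp: R_def)
    moreover have "0 \<le> (\<Sum>w\<in>(?W - N a) \<inter> (?W - N b). x w)" using x_nonneg by (simp add: sum_nonneg)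
    ultimately show ?thesis using sum.union_inter[of "?W - N a" "?W - N b" x] fin by simp
  qed
  have fE: "adj_form V E x x = adj_form ?W E x x + 2 * x b * (\<Sum>w\<in>nbrs ?W E b. x w) +
      2 * ((\<Sum>w\<in>nbrs ?W E a. x w) + (if {a, b} \<in> E then x b else 0))"
    using hub_form[OF loop ab] xa by simp
  \<comment> \<open>26 is 2 * 11 from the 11-degenerate graph on \<open>R\<close> plus 2 * 2 from
    the edges between \<open>R\<close> and the common neighbours.\<close>
  have fW: "adj_form ?W E x x \<le> (if {a, b} \<in> E then 0 else 12 * M\<^sup>2) + 26 * M * S"
  proof -
    have "adj_form ?W E x x = adj_form R E x x + adj_form ?D E x x + 2 * (\<Sum>v\<in>R. x v * (\<Sum>w\<in>nbrs ?D E v. x w))"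
      unfolding W(1) by (rule adj_form_Un[OF RV(2) finD W(2)])
    moreover have "adj_form R E x x \<le> 2 * real 11 * M * S"
    proof -
      have "adj_form R E x x \<le> 2 * 11 * M * (\<Sum>v\<in>R. x v)"
        using adj_form_degenerate_le[OF RV(2), of E 11 x M] degenerate RV(1) loop x_nonneg small
        by (force simp: R_def M_def)
      then show ?thesis by (simp add: S_def)
    qed
    moreover have "adj_form ?D E x x \<le> (if {a, b} \<in> E then 0 else 12 * M\<^sup>2)"
      by (rule common_form_le[OF ab D3]) (use small DW in \<open>auto simp: M_def\<close>)
    moreover have "(\<Sum>v\<in>R. x v * (\<Sum>w\<in>nbrs ?D E v. x w)) \<le> (\<Sum>v\<in>R. x v * (2 * M))"
    proof (intro sum_mono mult_left_mono x_nonneg)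
      fix v assume v: "v \<in> R"
      have "(\<Sum>w\<in>nbrs ?D E v. x w) \<le> (\<Sum>w\<in>nbrs ?D E v. M)" by (rule sum_mono) (use small DW in auto)
      also have "\<dots> = card (nbrs ?D E v) * M" by simp
      also have "\<dots> \<le> 2 * M" using card_N_common[OF ab, of v] v by (intro mult_right_mono) (auto simp: R_def M_def)
      finally show "(\<Sum>w\<in>nbrs ?D E v. x w) \<le> 2 * M" .
    qed
    moreover have "(\<Sum>v\<in>R. x v * (2 * M)) = 2 * M * S" unfolding S_def sum_distrib_right[symmetric] by simp
    ultimately show ?thesis by simp
  qed
  define q :: real where "q = (if {a, b} \<in> E then 0 else 1)"
  \<comment> \<open>Per unit of \<open>S\<close> the balance is 1.9 - 26 * 0.058 = 0.392. A missing
    hub edge (\<open>q = 1\<close>) brings at least 1.9 and costs at most 12 * 0.058^2, which is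
    below 0.05.\<close>
  have gain: "adj_form V ?T x x - adj_form V E x x \<ge> 39 / 100 * S + q"
  proof -
    let ?A = "\<Sum>w\<in>?W - N a. x w" and ?B = "\<Sum>w\<in>?W - N b. x w"
    have 1: "adj_form V ?T x x - adj_form V E x x = 2 * x b * ?B + 2 * ?A + 2 * q * x b - adj_form ?W E x x"
    proof -
      have "x b * (\<Sum>w\<in>?W. x w) = x b * (\<Sum>w\<in>nbrs ?W E b. x w) + x b * ?B"
        by (simp only: split[of b] distrib_left)
      moreover have "2 * q * x b = 2 * x b - 2 * (if {a, b} \<in> E then x b else 0)" by (simp add: q_def)
      moreover have "F - G = 2 * \<beta> * B + 2 * A + 2 * q * \<beta> - H"
        if "\<beta> * X = \<beta> * Y + \<beta> * B" "2 * q * \<beta> = 2 * \<beta> - 2 * i" "F = 2 * \<beta> * X + 2 * (X + \<beta>)"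
          "G = H + 2 * \<beta> * Y + 2 * (Z + i)" "X = Z + A" for F G H A B X Y Z i \<beta> :: real
        using that by algebra
      ultimately show ?thesis using fT fE split[of a] by blast
    qed
    have "x b * ?A \<le> 1 * ?A" using xb1 x_nonneg by (intro mult_right_mono) (simp_all add: sum_nonneg)
    moreover have "x b * S \<le> x b * (?A + ?B)" using Rsum xb by (intro mult_left_mono) auto
    moreover have "95 / 100 * S \<le> x b * S" using xb S0 by (rule mult_right_mono)
    ultimately have "2 * (95 / 100 * S) \<le> 2 * x b * ?B + 2 * ?A" by (simp add: distrib_left)
    moreover have "adj_form ?W E x x \<le> q * (5 / 100) + 26 * (58 / 1000) * S"
      using fW by (auto simp: q_def M_def power2_eq_square split: if_splits)
    moreover have "2 * q * x b \<ge> q * (190 / 100)" using xb by (simp add: q_def)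
    ultimately show ?thesis using 1 S0 by (simp add: q_def split: if_splits)
  qed
  have E: "adj_form V E x x = \<rho> * (\<Sum>v\<in>V. (x v)\<^sup>2)"
    unfolding adj_form_eq using eig by (simp add: sum_distrib_left power2_eq_square mult.left_commute)
  have nn: "0 \<le> (\<Sum>v\<in>V. (x v)\<^sup>2)" by (simp add: sum_nonneg)
  note ray = spectral_radius_Rayleigh(1)[OF fin V0, of ?T]
  have le: "spectral_radius V ?T * (\<Sum>v\<in>V. (x v)\<^sup>2) \<le> \<rho> * (\<Sum>v\<in>V. (x v)\<^sup>2)"
    by (rule mult_right_mono[OF extremal[OF ab] nn])
  \<comment> \<open>The hub form is at most \<open>\<rho>\<close> times the squared norm, which is
    the form of \<open>E\<close>; so the gain cannot be positive.\<close>
  have "39 / 100 * S + q \<le> 0" using gain E ray[of x] le by linarith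
  then have Sq: "S = 0" "{a, b} \<in> E" using S0 by (auto simp: q_def split: if_splits)
  have eq: "adj_form V ?T x x = spectral_radius V ?T * (\<Sum>v\<in>V. (x v)\<^sup>2)"
    using gain E ray[of x] le S0 by (simp add: Sq q_def)
  \<comment> \<open>Equality makes \<open>x\<close> an eigenvector of the hub graph too. A vertex of
    \<open>R\<close> has entry 0 because \<open>S = 0\<close>, while the neighbour sum in the hub
    graph there is \<open>x a + x b\<close>, which is positive.\<close>
  have R0: "R = {}"
  proof (rule ccontr)
    assume "R \<noteq> {}"
    then obtain v where v: "v \<in> R" by auto
    then have vW: "v \<in> V" "v \<noteq> a" "v \<noteq> b" by (auto simp: R_def)
    have "x v = 0" using Sq(1) v RV x_nonneg unfolding S_def by (simp add: sum_nonneg_eq_0_iff)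
    then have "(\<Sum>w\<in>nbrs V ?T v. x w) = 0"
      using adj_form_extremal_eigenvector[OF fin ray eq vW(1)] by simp
    moreover have "nbrs V ?T v = {a, b}" using hub vW ab by auto
    ultimately show False using ab xa xb by simp
  qed
  then have WD: "v \<in> ?D" if "v \<in> V" "v \<noteq> a" "v \<noteq> b" for v using that by (auto simp: R_def)
  have "{u, v} \<in> E \<longleftrightarrow> {u, v} \<in> ?T" if uv: "u \<in> V" "v \<in> V" for u v
  proof -
    have "{u, v} \<in> E \<longleftrightarrow> u \<noteq> v \<and> (u \<in> {a, b} \<or> v \<in> {a, b})"
    proof
      assume e: "{u, v} \<in> E"
      then have "u \<noteq> v" using loop by auto
      moreover have "u \<in> {a, b} \<or> v \<in> {a, b}"
        using common_independent[OF ab Sq(2) D3, of u v] WD uv e by blast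
      ultimately show "u \<noteq> v \<and> (u \<in> {a, b} \<or> v \<in> {a, b})" by simp
    next
      assume "u \<noteq> v \<and> (u \<in> {a, b} \<or> v \<in> {a, b})"
      then show "{u, v} \<in> E" using WD uv Sq(2) by (fastforce simp: insert_commute)
    qed
    then show ?thesis using hub[OF uv] by simp
  qed
  then show ?thesis using ab by blast
qed

end

section \<open>From planar graphs to the extremal graph\<close>

lemma no_K33_minor_common_nbrs:
  assumes no: "\<not> K33_minor (adj E) V" and loop: "\<And>v. {v} \<notin> E"
    and abc: "a \<in> V" "b \<in> V" "c \<in> V" "a \<noteq> b" "a \<noteq> c" "b \<noteq> c"
  shows "card (nbrs V E a \<inter> nbrs V E b \<inter> nbrs V E c) \<le> 2"
proof (rule ccontr)
  let ?C = "nbrs V E a \<inter> nbrs V E b \<inter> nbrs V E c"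
  assume "\<not> ?thesis"
  then have "3 \<le> card ?C" by simp
  then obtain T where T: "T \<subseteq> ?C" "card T = 3" "finite T" by (rule obtain_subset_with_card_n)
  obtain f where f: "bij_betw f {0..<3::nat} T" using ex_bij_betw_nat_finite[OF T(3)] T(2) by auto
  have fT: "f i \<in> ?C" if "i < 3" for i using bij_betwE[OF f] T(1) that by auto
  have fi: "f i \<noteq> f j" if "i < 3" "j < 3" "i \<noteq> j" for i j
    using f that by (auto simp: bij_betw_def inj_on_def)
  define g where "g i = (if i = 0 then a else if i = 1 then b else c)" for i :: nat
  have g: "g i \<in> {a, b, c}" "g i \<in> V" for i using abc by (auto simp: g_def)
  have gi: "g i \<noteq> g j" if "i < 3" "j < 3" "i \<noteq> j" for i j
    using that abc by (auto simp: g_def less_Suc_eq numeral_3_eq_3)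
  have gf: "{g i, f j} \<in> E" if "j < 3" for i j using fT[OF that] by (auto simp: g_def)
  have gf': "g i \<noteq> f j" if "j < 3" for i j using gf[OF that, of i] loop by auto
  have "K33_minor (adj E) V"
    unfolding K33_minor_def
    by (rule exI[of _ "\<lambda>i. {g i}"], rule exI[of _ "\<lambda>i. {f i}"])
      (use g(2) fT gi fi gf gf' in \<open>auto simp: conn_set_singleton\<close>)
  then show False using no by simp
qed

lemma C33_subgraphI:
  assumes "distinct [c, u, v, w, z]" "set [c, u, v, w, z] \<subseteq> V"
    and "{{c, u}, {u, v}, {c, v}, {c, w}, {w, z}, {c, z}} \<subseteq> E"
  shows "contains_subgraph V E C33_verts C33_edges"
  unfolding contains_subgraph_def
  by (rule exI[of _ "\<lambda>i. [c, u, v, w, z] ! i"])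
    (use assms in \<open>auto simp: C33_verts_def C33_edges_def inj_on_def\<close>)

text \<open>One implication carries the theorem: a radius at least that of the hub graph forces
  isomorphism, and isomorphic graphs have equal radius, so it can never be larger.\<close>

lemma bowtie_free_planar_extremal:
  fixes V :: "'a set" and E :: "'a set set"
  assumes G: "simple_graph V E" and big: "216 * 10 ^ 15 \<le> card V" and pl: "planar V E"
    and bow: "\<not> contains_subgraph V E C33_verts C33_edges"
    and ge: "spectral_radius (K2_join_verts (card V)) (K2_join_edges (card V)) \<le> spectral_radius V E"
  shows "graph_iso V E (K2_join_verts (card V)) (K2_join_edges (card V))"
proof -
  let ?\<rho> = "spectral_radius V E"
  have fin: "finite V" and loop: "\<And>v. {v} \<notin> E" using G by (auto simp: simple_graph_def)
  have n8: "8 \<le> card V" using big by simp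
  then have V0: "V \<noteq> {}" by auto
  have no: "\<not> K33_minor (adj E) V" by (rule planar_no_K33_minor[OF G pl])
  have hub: "spectral_radius V (hub_edges V a b) \<le> ?\<rho>" if "a \<in> V" "b \<in> V" "a \<noteq> b" for a b
    using graph_iso_spectral_radius[OF hub_edges_iso_K2_join[OF fin refl that]] ge by simp
  obtain y where y: "\<forall>v. 0 \<le> y v" "\<exists>v\<in>V. y v \<noteq> 0" "\<forall>v\<in>V. (\<Sum>w\<in>nbrs V E v. y w) = ?\<rho> * y v"
    using spectral_radius_Rayleigh(2)[OF fin V0, of E] by blast
  define m where "m = Max (y ` V)"
  have "m \<in> y ` V" unfolding m_def using fin V0 by (intro Max_in) auto
  then obtain u where u: "u \<in> V" "y u = m" by auto
  have ym: "y v \<le> m" if "v \<in> V" for v unfolding m_def using that fin by (intro Max_ge) auto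
  have m0: "m > 0"
  proof -
    obtain v where "v \<in> V" "y v \<noteq> 0" using y(2) by blast
    then show ?thesis using ym[of v] y(1) by (metis less_le order_less_le_trans)
  qed
  obtain a b where ab: "a \<in> V" "b \<in> V" "a \<noteq> b"
  proof -
    have "2 \<le> card V" using n8 by simp
    then obtain T where "T \<subseteq> V" "card T = 2" "finite T" by (rule obtain_subset_with_card_n)
    then show ?thesis using that by (auto simp: card_2_iff)
  qed
  \<comment> \<open>Any pair of hubs will do here; its hub graph supplies both
    \<open>0 \<le> ?\<rho>\<close> and the lower bound on \<open>?\<rho>\<^sup>2\<close>.\<close>
  note r = spectral_radius_hub_edges[OF fin refl n8 ab]
  interpret near_extremal V E "\<lambda>v. y v / m" ?\<rho>
  proof
    show "degree_sum (adj E) U < 12 * card U" if "U \<subseteq> V" "U \<noteq> {}" for U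
      by (rule no_K33_minor_sparse[OF no finite_subset[OF that(1) fin] that(2,1)])
        (use loop in \<open>auto simp: insert_commute\<close>)
    show "card (nbrs V E a \<inter> nbrs V E b \<inter> nbrs V E c) \<le> 2"
      if "a \<in> V" "b \<in> V" "c \<in> V" "a \<noteq> b" "a \<noteq> c" "b \<noteq> c" for a b c
      by (rule no_K33_minor_common_nbrs[OF no loop that])
    show False if "distinct [c, u, v, w, z]" "set [c, u, v, w, z] \<subseteq> V"
      "{{c, u}, {u, v}, {c, v}, {c, w}, {w, z}, {c, z}} \<subseteq> E" for c u v w z
      using C33_subgraphI[OF that] bow by simp
    show "\<exists>v\<in>V. y v / m = 1" using u m0 by auto
    show "(\<Sum>w\<in>nbrs V E v. y w / m) = ?\<rho> * (y v / m)" if "v \<in> V" for v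
      using y(3) that by (simp add: sum_divide_distrib[symmetric])
    show "0 \<le> ?\<rho>" using r(1) hub[OF ab] by linarith
    have "(spectral_radius V (hub_edges V a b))\<^sup>2 \<le> ?\<rho>\<^sup>2" using r(1) hub[OF ab] by (intro power_mono)
    then show "2 * real (card V) \<le> ?\<rho>\<^sup>2" using r(2) by linarith
  qed (use fin big loop y(1) ym m0 hub in auto)
  obtain a b where ab: "a \<in> V" "b \<in> V" "a \<noteq> b"
    and E: "\<forall>u\<in>V. \<forall>v\<in>V. {u, v} \<in> E \<longleftrightarrow> {u, v} \<in> hub_edges V a b"
    using is_hub_graph by blast
  have "graph_iso V (hub_edges V a b) (K2_join_verts (card V)) (K2_join_edges (card V))"
    by (rule hub_edges_iso_K2_join[OF fin refl ab])
  then show ?thesis unfolding graph_iso_def using E by auto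
qed

theorem theorem1:
  fixes V :: "'a set" and E :: "'a set set" and n :: nat
  assumes "simple_graph V E"
    and "card V = n"
    and "216 * 10 ^ 15 \<le> n"
    and "planar V E"
    and "\<not> contains_subgraph V E C33_verts C33_edges"
  shows "spectral_radius V E \<le> spectral_radius (K2_join_verts n) (K2_join_edges n)
    \<and> (spectral_radius V E = spectral_radius (K2_join_verts n) (K2_join_edges n)
         \<longleftrightarrow> graph_iso V E (K2_join_verts n) (K2_join_edges n))"
  using bowtie_free_planar_extremal[of V E] graph_iso_spectral_radius[of V E] assms
  by (metis linorder_le_cases order_refl)

end
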